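(* Let $0<\beta<\frac{\pi}{2}$ be a fixed acute angle and let $N$ be a non-negative integer. Then for all complex $\nu \neq 0$ with $-\frac{\pi}{2}<\arg\nu<\frac{\pi}{2}$, $$\mathbf{A}_{-\nu}(\nu\sec\beta) = -\frac{1}{\pi}\sum_{n=0}^{N-1}\frac{(2n)!\,a_n(-\sec\beta)}{\nu^{2n+1}} + R_N(\nu,\beta),$$ with coefficients $$a_n(-\sec\beta) = -\frac{1}{(2n)!}\left[\frac{d^{2n}}{dt^{2n}}\left(\frac{t}{\sec\beta\,\sinh t - t}\right)^{2n+1}\right]_{t=0} = \frac{(-1)^{n+1}}{(2n)!}\int_0^{+\infty} t^{2n}\, iH^{(1)}_{it}(it\sec\beta)\,dt$$ (both expressions being equal for every integer $n\ge 0$), and $$R_N(\nu,\beta) = \frac{(-1)^N}{\pi\nu^{2N+1}}\int_0^{+\infty}\frac{t^{2N}}{1+(t/\nu)^2}\, iH^{(1)}_{it}(it\sec\beta)\,dt .$$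
   Context: The Anger--Weber function is defined by $\mathbf{A}_{-\nu}(z) = \frac{1}{\pi}\int_0^{+\infty} e^{\nu t - z\sinh t}\,dt$ for $|\arg z|<\frac{\pi}{2}$ (so $\mathbf{A}_{-\nu}(\nu x)=\frac1\pi\int_0^{+\infty}e^{-\nu(x\sinh t-t)}dt$ for $x>0$, $|\arg\nu|<\frac\pi2$). $H^{(1)}_\mu(z)$ is the Hankel function of the first kind of order $\mu$ (principal branch; here $\arg(it\sec\beta)=\frac{\pi}{2}$ for $t>0$). In the derivative formula, $\frac{t}{\sec\beta\sinh t-t}$ is taken with its removable singularity at $t=0$ removed. Empty sums are zero. *)

theory Defs
  imports "HOL-Analysis.Analysis"
begin

text \<open>
  Functions of complex argument and complex order are taken on the principal branch:
  \<^const>\<open>powr\<close> on the complex numbers uses the logarithm with imaginary part in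
  \<open>(-\<pi>, \<pi>]\<close>.
\<close>

definition sec :: "real \<Rightarrow> real" where
  "sec x = 1 / cos x"

definition bessel_J :: "complex \<Rightarrow> complex \<Rightarrow> complex" where
  "bessel_J \<mu> z =
     (z / 2) powr \<mu> *
     (\<Sum>k. (-1) ^ k * (z\<^sup>2 / 4) ^ k * rGamma (\<mu> + of_nat k + 1) / fact k)"

definition bessel_Y_generic :: "complex \<Rightarrow> complex \<Rightarrow> complex" where
  "bessel_Y_generic \<mu> z =
     (bessel_J \<mu> z * cos (of_real pi * \<mu>) - bessel_J (-\<mu>) z) / sin (of_real pi * \<mu>)"

text \<open>At integer orders the usual quotient is of the form 0/0 and is replaced by its limit.\<close>

definition bessel_Y :: "complex \<Rightarrow> complex \<Rightarrow> complex" where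
  "bessel_Y \<mu> z =
     (if \<mu> \<in> \<int> then Lim (at \<mu>) (\<lambda>\<mu>'. bessel_Y_generic \<mu>' z) else bessel_Y_generic \<mu> z)"

definition hankel_H1 :: "complex \<Rightarrow> complex \<Rightarrow> complex" where
  "hankel_H1 \<mu> z = bessel_J \<mu> z + \<i> * bessel_Y \<mu> z"

text \<open>Meaningful for \<open>Re z > 0\<close>, i.e. \<open>\<bar>arg z\<bar> < \<pi>/2\<close>.\<close>

definition anger_weber :: "complex \<Rightarrow> complex \<Rightarrow> complex" where
  "anger_weber \<mu> z =
     1 / of_real pi *
     (LINT t:{0<..}|lborel. exp (- \<mu> * of_real t - z * of_real (sinh t)))"

text \<open>
  The function \<open>t / (s sinh t - t)\<close>; its limit at \<open>0\<close> is \<open>1 / (s - 1)\<close> for \<open>s \<noteq> 1\<close>.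
\<close>

definition sinh_quotient :: "real \<Rightarrow> real \<Rightarrow> real" where
  "sinh_quotient s t = (if t = 0 then 1 / (s - 1) else t / (s * sinh t - t))"

text \<open>The coefficient \<open>a\<^sub>n(x)\<close>; it is used at \<open>x = - sec \<beta>\<close>, whence \<open>-x\<close> below.\<close>

definition anger_weber_coeff :: "nat \<Rightarrow> real \<Rightarrow> real" where
  "anger_weber_coeff n x =
     - (1 / fact (2 * n)) *
     (deriv ^^ (2 * n)) (\<lambda>t. sinh_quotient (- x) t ^ (2 * n + 1)) 0"

definition hankel_weight :: "real \<Rightarrow> real \<Rightarrow> complex" where
  "hankel_weight \<beta> t =
     \<i> * hankel_H1 (\<i> * of_real t) (\<i> * of_real t * of_real (sec \<beta>))"

definition anger_weber_remainder :: "nat \<Rightarrow> complex \<Rightarrow> real \<Rightarrow> complex" where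
  "anger_weber_remainder N \<nu> \<beta> =
     (-1) ^ N / (of_real pi * \<nu> ^ (2 * N + 1)) *
     (LINT t:{0<..}|lborel.
        of_real t ^ (2 * N) / (1 + (of_real t / \<nu>)\<^sup>2) * hankel_weight \<beta> t)"

end

(*
  A_{-nu}(nu sec beta) is the Laplace transform of exp (- nu h), h x = sec beta sinh x - x.
  For imaginary order the Hankel function is, up to a factor exp (pi t / 2), a modified Bessel
  function K_{it}; moving the line of integration in its integral representation gives
  i H_{it}(i t sec beta) = (1/pi) * integral of exp (- t phi) with phi u = i h (u - i gamma),
  and Re phi u >= delta cosh u as soon as 0 < gamma < beta.  In the strip |Im z| < beta the odd
  function h takes real values only on the real axis, where it is injective.  Hence the moments of
  this weight and its cosine transform reduce to single residues, of 1 / h^(2n+1) at 0 and of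
  1 / (h - h x) at x.  The latter says that the cosine transform of the weight at h x is 1 / h' x,
  which yields the case N = 0; the general case is the finite geometric series for
  1 / (1 + (t/nu)^2).
*)
theory Submission
  imports Defs "HOL-Complex_Analysis.Complex_Analysis" "HOL-Real_Asymp.Real_Asymp"
begin

section \<open>Integrals over half-lines and lines\<close>

text \<open>The Hankel function is defined by power series, so its integral representation has to be
  built from them. In the integral of exp (\<mu> u - y cosh u) over u > 0, y cosh u splits into
  (y/2) exp u and (y/2) exp (- u). Expanding the exponential of the second part leaves incomplete
  Gamma functions: their complete Gamma parts sum to a Bessel series, and what remains is a double
  series odd in \<mu>, which cancels against the half-line u < 0. Taking \<gamma> = 0 is impossible:
  \<phi> would be purely imaginary, so that nothing converges absolutely, and the poles of 1 / h and
  1 / (h - h x) would lie on the line. The residue theorem yields only the difference between the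
  lines Im z = - \<gamma> and Im z = \<gamma>. The reflection z to - z exchanges them, and as h is
  odd this determines the integral on one line, but only for odd powers of 1 / h and for the sum
  over the poles x and - x. Hence exactly the even moments and the cosine transform of the weight
  become explicit.\<close>

lemma set_integral_FTC_Ioi:
  fixes F f :: "real \<Rightarrow> 'a::euclidean_space"
  assumes deriv: "\<And>x. (F has_vector_derivative f x) (at x)"
    and cont: "continuous_on UNIV f"
    and int: "set_integrable lborel {a<..} f"
    and lim: "(F \<longlongrightarrow> L) at_top"
  shows "(LINT x:{a<..}|lborel. f x) = L - F a"
proof -
  have "continuous_on UNIV F"
    using deriv by (meson continuous_at_imp_continuous_on has_vector_derivative_continuous)
  then have "isCont F a" by (simp add: continuous_on_eq_continuous_at)
  then have "(F \<longlongrightarrow> F a) (at_right a)"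
    by (simp add: isCont_def filterlim_at_split)
  then have "(LBINT x=ereal a..\<infinity>. f x) = L - F a"
    using assms cont
    by (intro interval_integral_FTC_integrable[where F = F])
       (auto simp: continuous_on_eq_continuous_at einterval_eq ereal_tendsto_simps)
  then show ?thesis by (simp add: interval_integral_to_infinity_eq)
qed

section \<open>Laplace transforms of powers and of the cosine\<close>

lemma power_div_fact_le_exp:
  assumes "0 \<le> (x::real)" shows "x ^ n / fact n \<le> exp x"
proof -
  have "summable (\<lambda>n. x ^ n /\<^sub>R fact n)" by (rule summable_exp_generic)
  then have "(\<Sum>i\<in>{n}. x ^ i /\<^sub>R fact i) \<le> (\<Sum>i. x ^ i /\<^sub>R fact i)"
    using assms by (intro sum_le_suminf) auto
  then show ?thesis by (simp add: exp_def divide_inverse mult.commute)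
qed

lemma set_integrable_exp_decay:
  assumes "0 < (c::real)" shows "set_integrable lborel {a<..} (\<lambda>t. exp (- (c * t)))"
proof -
  have "(\<lambda>t. exp (- c * t)) absolutely_integrable_on {a..}"
    by (intro nonnegative_absolutely_integrable_1 integrable_on_exp_minus_to_infinity assms) auto
  then have "set_integrable lborel {a..} (\<lambda>t. exp (- (c * t)))"
    by (simp add: set_integrable_def integrable_completion)
  then show ?thesis by (rule set_integrable_subset) auto
qed

lemma set_integrable_power_exp_decay:
  assumes "0 < (c::real)" shows "set_integrable lborel {0<..} (\<lambda>t. t ^ n * exp (- (c * t)))"
proof (rule set_integrable_bound)
  show "set_integrable lborel {0<..} (\<lambda>t. fact n * (2 / c) ^ n * exp (- (c / 2 * t)))"
    using set_integrable_exp_decay[of "c / 2" 0] assms by simp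
  have "t ^ n * exp (- (c * t)) \<le> fact n * (2 / c) ^ n * exp (- (c / 2 * t))" if "0 < t" for t
  proof -
    \<comment> \<open>Half of the decay rate is spent on absorbing t^n; the other half keeps the
      bound integrable.\<close>
    have "(c / 2 * t) ^ n / fact n \<le> exp (c / 2 * t)"
      using assms that by (intro power_div_fact_le_exp) auto
    then have "t ^ n \<le> fact n * (2 / c) ^ n * exp (c / 2 * t)"
      using assms by (simp add: field_simps power_divide power_mult_distrib)
    then have "t ^ n * exp (- (c * t)) \<le> fact n * (2 / c) ^ n * exp (c / 2 * t) * exp (- (c * t))"
      by (intro mult_right_mono) auto
    also have "\<dots> = fact n * (2 / c) ^ n * exp (- (c / 2 * t))"
      by (simp add: mult.assoc flip: exp_add)
    finally show ?thesis .
  qed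
  then show "AE t in lborel. t \<in> {0<..} \<longrightarrow>
      norm (t ^ n * exp (- (c * t))) \<le> norm (fact n * (2 / c) ^ n * exp (- (c / 2 * t)))"
    using assms by (auto simp: abs_mult)
qed (auto simp: set_borel_measurable_def)

lemma set_integrable_power_exp_complex:
  assumes "0 < Re z"
  shows "set_integrable lborel {0<..} (\<lambda>t. of_real t ^ n * exp (- (z * of_real t)))"
  by (rule set_integrable_bound[OF set_integrable_power_exp_decay[OF assms, of n]])
     (auto simp: set_borel_measurable_def norm_mult norm_power)

lemma tendsto_power_exp_complex:
  assumes "0 < Re z"
  shows "((\<lambda>t. of_real t ^ n * exp (- (z * of_real t))) \<longlongrightarrow> 0) at_top"
proof (rule tendsto_norm_zero_cancel)
  have "((\<lambda>t. t ^ n * exp (- (Re z * t))) \<longlongrightarrow> 0) at_top"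
    using assms by real_asymp
  then show "((\<lambda>t. norm (of_real t ^ n * exp (- (z * of_real t)))) \<longlongrightarrow> 0) at_top"
    by (rule Lim_transform_eventually)
       (auto intro!: eventually_mono[OF eventually_ge_at_top[of 0]] simp: norm_mult norm_power)
qed

lemma laplace_power:
  assumes z: "0 < Re z"
  shows "(LINT t:{0<..}|lborel. of_real t ^ n * exp (- (z * of_real t))) = fact n / z ^ Suc n"
proof (induction n)
  case 0
  have "(LINT t:{0<..}|lborel. exp (- (z * of_real t))) = 0 - (- exp (- (z * of_real 0)) / z)"
  proof (rule set_integral_FTC_Ioi[where F = "\<lambda>t. - exp (- (z * of_real t)) / z"])
    show "((\<lambda>t. - exp (- (z * of_real t)) / z) has_vector_derivative exp (- (z * of_real x))) (at x)"
      for x using z by (auto intro!: derivative_eq_intros has_vector_derivative_real_field)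
    show "((\<lambda>t. - exp (- (z * of_real t)) / z) \<longlongrightarrow> 0) at_top"
      using tendsto_divide[OF tendsto_minus[OF tendsto_power_exp_complex[OF z, of 0]]
          tendsto_const[of z]] z by force
  qed (use set_integrable_power_exp_complex[OF z, of 0] in \<open>auto intro!: continuous_intros\<close>)
  then show ?case by simp
next
  case (Suc n)
  let ?g = "\<lambda>n t. of_real t ^ n * exp (- (z * of_real t))"
  \<comment> \<open>Integration by parts: the integrand is the derivative of t^(n+1) exp (- z t),
    which vanishes at 0 and at infinity.\<close>
  have "(LINT t:{0<..}|lborel. of_nat (Suc n) * ?g n t - z * ?g (Suc n) t) = 0 - ?g (Suc n) 0"
  proof (rule set_integral_FTC_Ioi[where F = "?g (Suc n)"])
    show "(?g (Suc n) has_vector_derivative of_nat (Suc n) * ?g n x - z * ?g (Suc n) x) (at x)" for x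
    proof -
      have "((\<lambda>t. t ^ Suc n * exp (- (z * t))) has_field_derivative
          of_nat (Suc n) * ?g n x - z * ?g (Suc n) x) (at (of_real x))"
        by (rule derivative_eq_intros refl)+ (simp add: algebra_simps)
      from has_vector_derivative_real_field[OF this] show ?thesis .
    qed
  qed (use z in \<open>auto intro!: continuous_intros set_integral_diff set_integrable_mult_right
          set_integrable_power_exp_complex tendsto_power_exp_complex simp del: power_Suc of_nat_Suc\<close>)
  then have "of_nat (Suc n) * (LINT t:{0<..}|lborel. ?g n t) = z * (LINT t:{0<..}|lborel. ?g (Suc n) t)"
    using z by (subst (asm) set_integral_diff)
      (auto intro!: set_integrable_mult_right set_integrable_power_exp_complex simp del: power_Suc of_nat_Suc)
  then have "z * (LINT t:{0<..}|lborel. ?g (Suc n) t) = of_nat (Suc n) * (fact n / z ^ Suc n)"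
    by (simp add: Suc)
  moreover have "z \<noteq> 0" using z by auto
  ultimately show ?case by (simp add: field_simps)
qed

lemma laplace_real:
  fixes c :: real
  assumes "0 < c"
  shows "(LINT t:{0<..}|lborel. t ^ m * exp (- (c * t))) = fact m / c ^ Suc m"
proof -
  have "complex_of_real (LINT t:{0<..}|lborel. t ^ m * exp (- (c * t))) =
      (LINT t:{0<..}|lborel. complex_of_real (t ^ m * exp (- (c * t))))"
    by (rule set_integral_complex_of_real[symmetric])
  also have "\<dots> = (LINT t:{0<..}|lborel. of_real t ^ m * exp (- (of_real c * of_real t)))"
    by (simp flip: exp_of_real)
  also have "\<dots> = fact m / of_real c ^ Suc m"
    using assms by (intro laplace_power) simp
  also have "\<dots> = complex_of_real (fact m / c ^ Suc m)"
    by simp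
  finally show ?thesis by (simp only: of_real_eq_iff)
qed

lemma laplace_cos:
  assumes "0 < Re z"
  shows "(LINT t:{0<..}|lborel. cos (of_real (r * t)) * exp (- (z * of_real t))) =
    (1 / (z - \<i> * of_real r) + 1 / (z + \<i> * of_real r)) / 2"
proof -
  have int: "set_integrable lborel {0<..} (\<lambda>t. exp (- (w * of_real t)))"
    and val: "(LINT t:{0<..}|lborel. exp (- (w * of_real t))) = 1 / w" if "0 < Re w" for w
    using set_integrable_power_exp_complex[OF that, of 0] laplace_power[OF that, of 0] by simp_all
  have Re: "0 < Re (z - \<i> * of_real r)" "0 < Re (z + \<i> * of_real r)" using assms by simp_all
  have "cos (of_real (r * t)) * exp (- (z * of_real t)) =
      (exp (- ((z - \<i> * of_real r) * of_real t)) + exp (- ((z + \<i> * of_real r) * of_real t))) / 2" for t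
    by (simp add: cos_exp_eq field_simps mult_exp_exp flip: of_real_mult)
  then show ?thesis
    by (simp only: set_integral_divide_zero set_integral_add(2)[OF int[OF Re(1)] int[OF Re(2)]] val[OF Re(1)] val[OF Re(2)])
qed

section \<open>Integrals along horizontal lines and the residue between them\<close>

lemma contour_integral_linepath_same_Im:
  assumes "a < b"
  shows "contour_integral (linepath (Complex a c) (Complex b c)) f = integral {a..b} (\<lambda>x. f (Complex x c))"
proof -
  have 1: "linepath (Complex a c) (Complex b c) x = linepath (of_real a) (of_real b) x + Complex 0 c" for x
    by (simp add: linepath_def complex_eq_iff algebra_simps)
  have 2: "Complex b c - Complex a c = of_real b - of_real a" by (simp add: complex_eq_iff)
  have 3: "of_real x + Complex 0 c = Complex x c" for x by (simp add: complex_eq_iff)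
  have "contour_integral (linepath (Complex a c) (Complex b c)) f =
      contour_integral (linepath (of_real a) (of_real b)) (\<lambda>z. f (z + Complex 0 c))"
    by (simp only: contour_integral_integral vector_derivative_linepath_at 1 2)
  also have "\<dots> = integral {a..b} (\<lambda>x. f (of_real x + Complex 0 c))"
    using assms by (subst contour_integral_linepath_Reals_eq) auto
  finally show ?thesis by (simp only: 3)
qed

lemma tendsto_integral_symmetric_interval:
  fixes f :: "real \<Rightarrow> 'a::euclidean_space"
  assumes "integrable lborel f"
  shows "((\<lambda>R. integral {-R..R} f) \<longlongrightarrow> (\<integral>x. f x \<partial>lborel)) at_top"
proof -
  have [measurable]: "f \<in> borel_measurable lborel" using assms by auto
  have "((\<lambda>R. \<integral>x. indicator {-R..R} x *\<^sub>R f x \<partial>lborel) \<longlongrightarrow> (\<integral>x. f x \<partial>lborel)) at_top"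
  proof (rule integral_dominated_convergence_at_top)
    show "integrable lborel (\<lambda>x. norm (f x))" using assms by auto
    have "((\<lambda>R. indicator {-R..R} x *\<^sub>R f x) \<longlongrightarrow> f x) at_top" for x
      by (rule tendsto_eventually, rule eventually_mono[OF eventually_ge_at_top[of "\<bar>x\<bar>"]]) (auto simp: indicator_def)
    then show "AE x in lborel. ((\<lambda>R. indicator {-R..R} x *\<^sub>R f x) \<longlongrightarrow> f x) at_top" by simp
    show "\<forall>\<^sub>F R in at_top. AE x in lborel. norm (indicator {-R..R} x *\<^sub>R f x) \<le> norm (f x)"
      by (intro always_eventually allI AE_I2) (auto simp: indicator_def)
  qed auto
  moreover have "(\<integral>x. indicator {-R..R} x *\<^sub>R f x \<partial>lborel) = integral {-R..R} f" for R
  proof -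
    have "set_integrable lborel {-R..R} f"
      using assms unfolding set_integrable_def by (intro integrable_mult_indicator) auto
    from set_borel_integral_eq_integral(2)[OF this] show ?thesis
      by (simp add: set_lebesgue_integral_def)
  qed
  ultimately show ?thesis by simp
qed

text \<open>The residue theorem on the rectangles with real parts in [-R, R] and imaginary parts in
  [c, d]; the bound \<open>D\<close> removes the vertical sides as R grows. \<open>G\<close> may be
  regular at \<open>p\<close>, in which case the residue is 0 and the lemma becomes Cauchy's theorem
  for moving a line of integration.\<close>

lemma strip_residue:
  assumes ord: "c' < c" "c < Im p" "Im p < d" "d < d'"
    and holo: "G holomorphic_on {z. c' < Im z \<and> Im z < d'} - {p}"
    and bound: "\<And>x y. X \<le> \<bar>x\<bar> \<Longrightarrow> c \<le> y \<Longrightarrow> y \<le> d \<Longrightarrow> cmod (G (Complex x y)) \<le> D \<bar>x\<bar>"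
    and D: "(D \<longlongrightarrow> 0) at_top"
    and ic: "integrable lborel (\<lambda>x. G (Complex x c))"
    and id: "integrable lborel (\<lambda>x. G (Complex x d))"
  shows "(\<integral>x. G (Complex x c) \<partial>lborel) - (\<integral>x. G (Complex x d) \<partial>lborel) = 2 * pi * \<i> * residue G p"
proof -
  define S where "S = {z. c' < Im z \<and> Im z < d'}"
  have S_eq: "S = {z. c' < Im z} \<inter> {z. Im z < d'}" by (auto simp: S_def)
  have S: "open S" "connected S"
    unfolding S_eq by (auto intro!: open_Int open_halfspace_Im_gt open_halfspace_Im_lt convex_connected
        convex_Int convex_halfspace_Im_gt convex_halfspace_Im_lt)
  have cont: "continuous_on (S - {p}) G" using holo S_def holomorphic_on_imp_continuous_on by blast
  define I where "I = (\<lambda>y R. integral {-R..R} (\<lambda>x. G (Complex x y)))"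
  define V where "V = (\<lambda>R. integral {c..d} (\<lambda>y. G (Complex R y)))"
  have key: "I c R + \<i> * V R - I d R - \<i> * V (-R) = 2 * pi * \<i> * residue G p"
    and V: "cmod (V R) \<le> D R * (d - c)" "cmod (V (-R)) \<le> D R * (d - c)"
    if R: "\<bar>Re p\<bar> < R" "X \<le> R" for R
  proof -
    have R0: "0 < R" using R by linarith
    define a1 a2 a3 a4 where "a1 = Complex (-R) c" "a2 = Complex R c" "a3 = Complex R d" "a4 = Complex (-R) d"
    note a_defs = this
    have rect: "rectpath a1 a3 = linepath a1 a2 +++ linepath a2 a3 +++ linepath a3 a4 +++ linepath a4 a1"
      by (simp add: rectpath_def Let_def a_defs)
    have pim: "path_image (rectpath a1 a3) \<subseteq> S - {p}"
      using ord R R0 by (subst path_image_rectpath) (auto simp: S_def a_defs)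
    have sub: "closed_segment a1 a2 \<subseteq> S - {p}" "closed_segment a2 a3 \<subseteq> S - {p}"
      "closed_segment a3 a4 \<subseteq> S - {p}" "closed_segment a4 a1 \<subseteq> S - {p}"
      using pim unfolding rect by (auto simp: path_image_join)
    have int: "G contour_integrable_on linepath a b" if "closed_segment a b \<subseteq> S - {p}" for a b
      using that cont continuous_on_subset by (blast intro: contour_integrable_continuous_linepath)
    have "contour_integral (rectpath a1 a3) G =
        contour_integral (linepath a1 a2) G + (contour_integral (linepath a2 a3) G +
        (contour_integral (linepath a3 a4) G + contour_integral (linepath a4 a1) G))"
      unfolding rect
      by (intro contour_integral_unique has_contour_integral_join valid_path_join valid_path_linepath
          has_contour_integral_integral int sub) auto
    also have "contour_integral (linepath a3 a4) G = - contour_integral (linepath a4 a3) G"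
      using int sub by (metis contour_integral_reversepath reversepath_linepath valid_path_linepath)
    also have "contour_integral (linepath a4 a1) G = - contour_integral (linepath a1 a4) G"
      using int sub by (metis contour_integral_reversepath reversepath_linepath valid_path_linepath)
    also have "contour_integral (linepath a1 a2) G = I c R"
      unfolding a_defs I_def using R0 by (intro contour_integral_linepath_same_Im) auto
    also have "contour_integral (linepath a4 a3) G = I d R"
      unfolding a_defs I_def using R0 by (intro contour_integral_linepath_same_Im) auto
    also have "contour_integral (linepath a2 a3) G = \<i> * V R"
      unfolding a_defs V_def using ord by (intro contour_integral_linepath_same_Re) auto
    also have "contour_integral (linepath a1 a4) G = \<i> * V (-R)"
      unfolding a_defs V_def using ord by (intro contour_integral_linepath_same_Re) auto
    finally have sides: "contour_integral (rectpath a1 a3) G =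
        I c R + (\<i> * V R + (- I d R + - (\<i> * V (-R))))" .
    have "contour_integral (rectpath a1 a3) G =
        2 * pi * \<i> * (\<Sum>q\<in>{p}. winding_number (rectpath a1 a3) q * residue G q)"
    proof (rule Residue_theorem[where S = S])
      show "\<forall>z. z \<notin> S \<longrightarrow> winding_number (rectpath a1 a3) z = 0"
        using ord R0 by (auto intro!: winding_number_rectpath_outside simp: a_defs S_def in_cbox_complex_iff)
    qed (use S holo pim in \<open>auto simp: S_def\<close>)
    moreover have "winding_number (rectpath a1 a3) p = 1"
      using ord R by (intro winding_number_rectpath) (auto simp: a_defs in_box_complex_iff)
    ultimately show "I c R + \<i> * V R - I d R - \<i> * V (-R) = 2 * pi * \<i> * residue G p"
      using sides by (simp add: algebra_simps)
    have V_bound: "cmod (V x) \<le> D R * (d - c)" if "\<bar>x\<bar> = R" for x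
      unfolding V_def
    proof (rule integral_bound)
      show "continuous_on {c..d} (\<lambda>y. G (Complex x y))"
        by (rule continuous_on_compose2[OF cont]) 
           (use that R ord in \<open>auto simp: S_def Complex_eq intro!: continuous_intros\<close>)
      show "cmod (G (Complex x y)) \<le> D R" if "y \<in> {c..d}" for y
        using bound[of x y] that \<open>\<bar>x\<bar> = R\<close> R by auto
    qed (use ord in auto)
    show "cmod (V R) \<le> D R * (d - c)" "cmod (V (-R)) \<le> D R * (d - c)"
      using V_bound R0 by auto
  qed
  \<comment> \<open>The rectangle encloses \<open>p\<close> once R exceeds its real part in modulus,
    and the bound holds on the vertical sides once R is at least \<open>X\<close>.\<close>
  have ev: "\<forall>\<^sub>F R in at_top. \<bar>Re p\<bar> < R \<and> X \<le> R"
    by (intro eventually_conj eventually_gt_at_top eventually_ge_at_top)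
  have D0: "((\<lambda>R. D R * (d - c)) \<longlongrightarrow> 0) at_top" using tendsto_mult_left_zero[OF D] .
  have "(V \<longlongrightarrow> 0) at_top" "((\<lambda>R. V (-R)) \<longlongrightarrow> 0) at_top"
    by (rule Lim_null_comparison[OF eventually_mono[OF ev] D0], use V in blast)+
  moreover have "((\<lambda>R. I c R) \<longlongrightarrow> (\<integral>x. G (Complex x c) \<partial>lborel)) at_top"
    "((\<lambda>R. I d R) \<longlongrightarrow> (\<integral>x. G (Complex x d) \<partial>lborel)) at_top"
    unfolding I_def using ic id by (auto intro: tendsto_integral_symmetric_interval)
  ultimately have "((\<lambda>R. I c R + \<i> * V R - I d R - \<i> * V (-R)) \<longlongrightarrow>
      (\<integral>x. G (Complex x c) \<partial>lborel) + \<i> * 0 - (\<integral>x. G (Complex x d) \<partial>lborel) - \<i> * 0) at_top"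
    by (intro tendsto_intros)
  moreover have "((\<lambda>R. I c R + \<i> * V R - I d R - \<i> * V (-R)) \<longlongrightarrow> 2 * pi * \<i> * residue G p) at_top"
    by (rule tendsto_eventually, rule eventually_mono[OF ev]) (use key in blast)
  ultimately show ?thesis
    using tendsto_unique[OF trivial_limit_at_top_linorder] by fastforce
qed

lemma integrable_product_lborel:
  fixes f :: "real \<Rightarrow> complex" and g :: "real \<Rightarrow> complex"
  assumes f: "integrable lborel f" and g: "integrable lborel g"
  shows "integrable (lborel \<Otimes>\<^sub>M lborel) (\<lambda>(x, t). f x * g t)"
proof (rule lborel_pair.Fubini_integrable)
  have [measurable]: "f \<in> borel_measurable borel" "g \<in> borel_measurable borel"
    using f g by (auto dest: borel_measurable_integrable)
  show "(\<lambda>(x, t). f x * g t) \<in> borel_measurable (lborel \<Otimes>\<^sub>M lborel)" by measurable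
  show "integrable lborel (\<lambda>x. \<integral>t. norm (case (x, t) of (x, t) \<Rightarrow> f x * g t) \<partial>lborel)"
    using f by (simp add: norm_mult)
  show "AE x in lborel. integrable lborel (\<lambda>t. case (x, t) of (x, t) \<Rightarrow> f x * g t)"
    using g by simp
qed

section \<open>The integral representation of the modified Bessel function\<close>

lemma integral_split_at_0:
  fixes f :: "real \<Rightarrow> 'a::euclidean_space"
  assumes pos: "set_integrable lborel {0<..} f" and neg: "set_integrable lborel {0<..} (\<lambda>x. f (- x))"
  shows "integrable lborel f"
    and "(\<integral>x. f x \<partial>lborel) = (LINT x:{0<..}|lborel. f x) + (LINT x:{0<..}|lborel. f (- x))"
proof -
  have "integrable lborel (\<lambda>x. indicator {0<..} (0 + (-1) * x) *\<^sub>R f (- (0 + (-1) * x)))"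
    using neg unfolding set_integrable_def by (rule lborel_integrable_real_affine) simp
  then have neg': "set_integrable lborel {..<0} f"
    unfolding set_integrable_def
    by (rule Bochner_Integration.integrable_cong[THEN iffD1, rotated -1]) (auto simp: indicator_def)
  have "integrable lborel (\<lambda>x. indicator {0::real} x *\<^sub>R f 0)"
    by (intro integrable_scaleR_left) (auto intro!: integrable_real_indicator)
  then have "set_integrable lborel {0::real} f" unfolding set_integrable_def
    by (rule Bochner_Integration.integrable_cong[THEN iffD1, rotated -1]) (auto simp: indicator_def)
  note U = set_integrable_Un[OF set_integrable_Un[OF pos neg'] this]
  have eq: "{0<..} \<union> {..<0} \<union> {0::real} = UNIV" by auto
  from U show "integrable lborel f" unfolding eq by (simp add: set_integrable_def)
  have "(\<integral>x. f x \<partial>lborel) = (LINT x:({0<..} \<union> {..<0})|lborel. f x)"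
    unfolding set_lebesgue_integral_def
    using \<open>integrable lborel f\<close>
    by (intro integral_cong_AE eventually_mono[OF AE_lborel_singleton[of 0]])
       (auto simp: indicator_def intro!: borel_measurable_scaleR)
  also have "\<dots> = (LINT x:{0<..}|lborel. f x) + (LINT x:{..<0}|lborel. f x)"
    using pos neg' by (intro set_integral_Un) auto
  also have "(LINT x:{..<0}|lborel. f x) = (LINT x:{0<..}|lborel. f (- x))"
    by (subst set_integral_reflect) (simp add: greaterThan_def)
  finally show "(\<integral>x. f x \<partial>lborel) = (LINT x:{0<..}|lborel. f x) + (LINT x:{0<..}|lborel. f (- x))" .
qed

section \<open>Incomplete Gamma functions in an exponential variable\<close>

text \<open>Since exp u is at least u^2 / 2, completing the square beats any linear exponent,
  whatever the sign of Re a.\<close>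

lemma set_integrable_exp_double_exp:
  fixes a :: complex
  assumes "0 < c"
  shows "set_integrable lborel {0<..} (\<lambda>u. exp (a * of_real u - of_real (c * exp u)))"
proof (rule set_integrable_bound)
  \<comment> \<open>The extra 1 leaves a spare - u in the exponent after the square is
    completed.\<close>
  define b where "b = Re a + 1"
  show "set_integrable lborel {0<..} (\<lambda>u. exp (b\<^sup>2 / (2 * c)) * exp (- (1 * u)))"
    using set_integrable_exp_decay[of 1 0] by (intro set_integrable_mult_right) auto
  have "Re a * u - c * exp u \<le> b\<^sup>2 / (2 * c) - u" if "0 < u" for u
  proof -
    have "u\<^sup>2 / 2 \<le> exp u"
      using power_div_fact_le_exp[of u 2] that by (simp add: fact_numeral)
    then have "c * (u\<^sup>2 / 2) \<le> c * exp u" using assms by (intro mult_left_mono) auto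
    moreover have "b * u \<le> b\<^sup>2 / (2 * c) + c * (u\<^sup>2 / 2)"
    proof -
      have "0 \<le> (b - c * u)\<^sup>2" by simp
      then have "2 * (b * (c * u)) \<le> b\<^sup>2 + (c * u)\<^sup>2" by (simp add: power2_diff mult.assoc)
      then show ?thesis using assms by (simp add: field_simps power2_eq_square)
    qed
    ultimately show ?thesis by (simp add: b_def algebra_simps)
  qed
  then show "AE u in lborel. u \<in> {0<..} \<longrightarrow> norm (exp (a * of_real u - of_real (c * exp u)))
      \<le> norm (exp (b\<^sup>2 / (2 * c)) * exp (- (1 * u)))"
    by (auto simp flip: exp_add)
qed (auto simp: set_borel_measurable_def)

text \<open>With v = c exp u this is c^(-a) times the upper incomplete Gamma function at (a,
  c).\<close>

definition exp_double_exp_integral :: "real \<Rightarrow> complex \<Rightarrow> complex" where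
  "exp_double_exp_integral c a = (LINT u:{0<..}|lborel. exp (a * of_real u - of_real (c * exp u)))"

text \<open>The integral over u > 0 of the derivative of exp (a u - c exp u); the boundary value at
  0 is exp (- c). This is the recurrence of the incomplete Gamma function, and it carries identities
  across the line Re a = 0.\<close>

lemma exp_double_exp_integral_step:
  assumes "0 < c"
  shows "c * exp_double_exp_integral c (a + 1) = exp (- of_real c) + a * exp_double_exp_integral c a"
proof -
  let ?f = "\<lambda>a u. exp (a * of_real u - of_real (c * exp u))"
  have int: "set_integrable lborel {0<..} (?f a)" for a :: complex
    using assms by (rule set_integrable_exp_double_exp)
  have "(LINT u:{0<..}|lborel. a * ?f a u - c * ?f (a + 1) u) = 0 - ?f a 0"
  proof (rule set_integral_FTC_Ioi[where F = "?f a"])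
    show "(?f a has_vector_derivative a * ?f a x - c * ?f (a + 1) x) (at x)" for x
    proof -
      have "((\<lambda>z. exp (a * z - of_real c * exp z)) has_field_derivative
          (a - of_real c * exp (of_real x)) * exp (a * of_real x - of_real c * exp (of_real x))) (at (of_real x))"
        by (auto intro!: derivative_eq_intros)
      then have "((\<lambda>z. exp (a * z - of_real c * exp z)) has_field_derivative a * ?f a x - c * ?f (a + 1) x)
          (at (of_real x))"
        by (simp add: algebra_simps exp_add exp_diff diff_divide_distrib flip: exp_of_real)
      from has_vector_derivative_real_field[OF this] show ?thesis
        by (simp flip: exp_of_real)
    qed
    show "(?f a \<longlongrightarrow> 0) at_top"
    proof (rule tendsto_norm_zero_cancel)
      have "((\<lambda>u. exp (Re a * u - c * exp u)) \<longlongrightarrow> 0) at_top"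
        using assms by real_asymp
      then show "((\<lambda>u. norm (?f a u)) \<longlongrightarrow> 0) at_top" by simp
    qed
  qed (intro continuous_intros set_integral_diff set_integrable_mult_right int)+
  moreover have "set_integrable lborel {0<..} (\<lambda>u. b * ?f a u)" for a b :: complex
    by (rule set_integrable_mult_right) (rule int)
  ultimately have "a * (LINT u:{0<..}|lborel. ?f a u) - c * (LINT u:{0<..}|lborel. ?f (a + 1) u) = - ?f a 0"
    by (simp only: set_integral_diff(2) set_integral_mult_right diff_0)
  then have "a * exp_double_exp_integral c a - c * exp_double_exp_integral c (a + 1) = - exp (- of_real c)"
    unfolding exp_double_exp_integral_def by (simp only: of_real_0 mult_zero_right exp_zero mult_1_right diff_0)
  moreover have "p - q = - e \<Longrightarrow> q = e + p" for p q e :: complex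
    by (simp add: diff_eq_eq)
  ultimately show ?thesis by blast
qed

text \<open>Termwise integration of the power series of exp (- c exp (- u)). For u > 0 every exp (-
  k u) is at most 1, so the k-th term is dominated by c^k / k! times the norm of \<open>g\<close>;
  this is the reason for working on half-lines.\<close>

lemma sums_set_integral_exp_exp_minus:
  fixes g :: "real \<Rightarrow> complex"
  assumes g: "set_integrable lborel {0<..} g" and c: "0 < c"
  shows "(\<lambda>k. (- of_real c) ^ k / fact k * (LINT u:{0<..}|lborel. g u * exp (- (of_nat k * of_real u)))) sums
      (LINT u:{0<..}|lborel. g u * exp (- of_real (c * exp (- u))))"
    and "set_integrable lborel {0<..} (\<lambda>u. g u * exp (- of_real (c * exp (- u))))"
proof -
  let ?x = "\<lambda>k. (- of_real c) ^ k / fact k :: complex"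
  let ?f = "\<lambda>k u. ?x k * (indicator {0<..} u *\<^sub>R (g u * exp (- (of_nat k * of_real u))))"
  have meas: "set_borel_measurable lborel {0<..} g"
    using g by (simp add: set_integrable_def set_borel_measurable_def borel_measurable_integrable)
  have meas': "set_borel_measurable lborel {0<..} (\<lambda>u. g u * h u)"
    if "h \<in> borel_measurable lborel" for h
    using borel_measurable_times[OF meas[unfolded set_borel_measurable_def] that]
    by (simp add: set_borel_measurable_def)
  show int: "set_integrable lborel {0<..} (\<lambda>u. g u * exp (- of_real (c * exp (- u))))"
    by (rule set_integrable_bound[OF g meas']) (use c in \<open>auto simp: norm_mult mult_left_le\<close>)
  have int_k: "set_integrable lborel {0<..} (\<lambda>u. g u * exp (- (of_nat k * of_real u)))" for k
    by (rule set_integrable_bound[OF g meas']) (auto simp: norm_mult mult_left_le)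
  have sums: "(\<lambda>k. ?f k u) sums (indicator {0<..} u *\<^sub>R (g u * exp (- of_real (c * exp (- u)))))" for u
  proof -
    have "(\<lambda>k. (- of_real (c * exp (- u))) ^ k /\<^sub>R fact k) sums exp (- of_real (c * exp (- u)) :: complex)"
      by (rule exp_converges)
    then have "(\<lambda>k. indicator {0<..} u *\<^sub>R g u * ((- of_real (c * exp (- u))) ^ k /\<^sub>R fact k)) sums
        (indicator {0<..} u *\<^sub>R g u * exp (- of_real (c * exp (- u)) :: complex))"
      by (rule sums_mult)
    also have "(\<lambda>k. indicator {0<..} u *\<^sub>R g u * ((- of_real (c * exp (- u))) ^ k /\<^sub>R fact k)) = (\<lambda>k. ?f k u)"
    proof
      fix k
      have "(- of_real (c * exp (- u))) ^ k = (- of_real c) ^ k * (exp (- (of_nat k * of_real u)) :: complex)"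
        by (metis (no_types, lifting) exp_of_nat_mult exp_of_real mult_minus_left mult_minus_right of_real_minus of_real_mult power_mult_distrib)
      then show "indicator {0<..} u *\<^sub>R g u * ((- of_real (c * exp (- u))) ^ k /\<^sub>R fact k) = ?f k u"
        by (simp add: scaleR_conv_of_real divide_inverse)
    qed
    finally show ?thesis by simp
  qed
  have norm_f: "norm (?f k u) \<le> c ^ k / fact k * norm (indicator {0<..} u *\<^sub>R g u)" for k u
    using c by (auto simp: norm_mult norm_power norm_divide indicator_def
        intro!: divide_right_mono mult_left_mono mult_left_le)
  have exp_c: "summable (\<lambda>k. c ^ k / fact k)"
    using summable_exp_generic[of c] by (simp add: divide_inverse mult.commute)
  have "(\<lambda>k. \<integral>u. ?f k u \<partial>lborel) sums (\<integral>u. (\<Sum>k. ?f k u) \<partial>lborel)"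
  proof (rule sums_integral)
    show 1: "integrable lborel (?f k)" for k
      using int_k[of k] unfolding set_integrable_def by (rule integrable_mult_right)
    show "AE u in lborel. summable (\<lambda>k. norm (?f k u))"
      by (intro AE_I2 summable_comparison_test'[OF summable_mult2[OF exp_c]]) (use norm_f in auto)
    show "summable (\<lambda>k. \<integral>u. norm (?f k u) \<partial>lborel)"
    proof (rule summable_comparison_test'[OF summable_mult2[OF exp_c]])
      fix k
      have "(\<integral>u. norm (?f k u) \<partial>lborel) \<le> (\<integral>u. c ^ k / fact k * norm (indicator {0<..} u *\<^sub>R g u) \<partial>lborel)"
        using g unfolding set_integrable_def by (intro integral_mono integrable_norm 1 norm_f integrable_mult_right)
      then show "norm (\<integral>u. norm (?f k u) \<partial>lborel) \<le>
          c ^ k / fact k * (\<integral>u. norm (indicator {0<..} u *\<^sub>R g u) \<partial>lborel)"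
        by (simp add: integral_nonneg)
    qed
  qed
  moreover have "(\<integral>u. ?f k u \<partial>lborel) = ?x k * (LINT u:{0<..}|lborel. g u * exp (- (of_nat k * of_real u)))" for k
    unfolding set_lebesgue_integral_def by (rule integral_mult_right_zero)
  moreover have "(\<Sum>k. ?f k u) = indicator {0<..} u *\<^sub>R (g u * exp (- of_real (c * exp (- u))))" for u
    using sums[of u] by (rule sums_unique[symmetric])
  ultimately show "(\<lambda>k. ?x k * (LINT u:{0<..}|lborel. g u * exp (- (of_nat k * of_real u)))) sums
      (LINT u:{0<..}|lborel. g u * exp (- of_real (c * exp (- u))))"
    by (simp only: set_lebesgue_integral_def)
qed

text \<open>Euler's integral for Gamma under the substitution t = c exp u.\<close>

lemma exp_double_exp_integral_whole_line:
  assumes a: "0 < Re a" and c: "0 < c"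
  shows "(\<integral>u. exp (a * of_real u - of_real (c * exp u)) \<partial>lborel) = of_real c powr (- a) * Gamma a"
proof -
  let ?f = "\<lambda>t. complex_of_real t powr (a - 1) / of_real (exp t)"
  let ?g = "\<lambda>u. exp (a * of_real u - of_real (c * exp u))"
  have range: "range (\<lambda>u. c * exp u) = {0<..}"
  proof (intro equalityI subsetI)
    fix x :: real assume "x \<in> {0<..}"
    then have "x = c * exp (ln (x / c))" using c by simp
    then show "x \<in> range (\<lambda>u. c * exp u)" by blast
  qed (use c in auto)
  have eq: "\<bar>c * exp u\<bar> *\<^sub>R ?f (c * exp u) = of_real c powr a * ?g u" for u
  proof -
    have "\<bar>c * exp u\<bar> *\<^sub>R ?f (c * exp u) = of_real (c * exp u) powr a * exp (- of_real (c * exp u))"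
      using c by (simp add: scaleR_conv_of_real powr_diff exp_minus field_simps flip: exp_of_real)
    also have "of_real (c * exp u) powr a = of_real c powr a * (of_real (exp u) powr a :: complex)"
      using c by (simp add: powr_times_real)
    also have "of_real (exp u) powr a = exp (a * of_real u)"
      by (simp add: powr_def Ln_of_real flip: exp_of_real)
    finally show ?thesis by (simp add: exp_diff exp_minus divide_inverse)
  qed
  have "(\<lambda>u. \<bar>c * exp u\<bar> *\<^sub>R ?f (c * exp u)) absolutely_integrable_on UNIV \<and>
      integral UNIV (\<lambda>u. \<bar>c * exp u\<bar> *\<^sub>R ?f (c * exp u)) = Gamma a"
  proof (subst has_absolute_integral_change_of_variables_real[where g = "\<lambda>u. c * exp u"])
    show "?f absolutely_integrable_on range (\<lambda>u. c * exp u) \<and> integral (range (\<lambda>u. c * exp u)) ?f = Gamma a"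
      unfolding range using absolutely_integrable_Gamma_integral'[OF a] Gamma_integral_complex'[OF a]
      by auto
  qed (use c in \<open>auto intro!: derivative_eq_intros injI\<close>)
  then have *: "(\<lambda>u. of_real c powr a * ?g u) absolutely_integrable_on UNIV"
      "integral UNIV (\<lambda>u. of_real c powr a * ?g u) = Gamma a"
    unfolding eq by blast+
  define A where "A = (of_real c powr a :: complex)"
  have A: "A \<noteq> 0" using c by (simp add: A_def powr_def)
  have int: "integrable lborel (\<lambda>u. A * ?g u)"
    using *(1) unfolding A_def by (simp add: set_integrable_def integrable_completion)
  have "A * (\<integral>u. ?g u \<partial>lborel) = (\<integral>u. A * ?g u \<partial>lborel)"
    by (rule integral_mult_right_zero[symmetric])
  also have "\<dots> = Gamma a"
    using *(2) integral_lborel[OF int] unfolding A_def by (metis (no_types))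
  finally have "(\<integral>u. ?g u \<partial>lborel) = inverse A * Gamma a"
    using A by (metis left_inverse mult.assoc mult_1)
  then show "(\<integral>u. ?g u \<partial>lborel) = of_real c powr (- a) * Gamma a"
    by (simp only: A_def powr_minus)
qed

text \<open>This is c^(-a) times the lower incomplete Gamma function at (a, c), as a partial
  fraction series with poles at the non-positive integers.\<close>

definition exp_partial_fractions :: "real \<Rightarrow> complex \<Rightarrow> complex" where
  "exp_partial_fractions c a = (\<Sum>j. (- of_real c) ^ j / fact j / (a + of_nat j))"

lemma norm_add_of_nat_ge: "\<bar>Im a\<bar> \<le> cmod (a + of_nat j)"
  using abs_Im_le_cmod[of "a + of_nat j"] by simp

lemma summable_exp_series: "summable (\<lambda>k. \<bar>c::real\<bar> ^ k / fact k)"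
  using summable_exp_generic[of "\<bar>c\<bar>"] by (simp add: divide_inverse mult.commute)

lemma norm_partial_fraction_le:
  assumes "Im a \<noteq> 0"
  shows "cmod ((- of_real c) ^ j / fact j / (a + of_nat j)) \<le> \<bar>c\<bar> ^ j / fact j / \<bar>Im a\<bar>"
proof -
  have "0 < \<bar>Im a\<bar>" "\<bar>Im a\<bar> \<le> cmod (a + of_nat j)" using assms norm_add_of_nat_ge by auto
  then show ?thesis
    by (simp only: norm_divide norm_power norm_fact norm_minus_cancel norm_of_real)
       (intro divide_left_mono mult_pos_pos; force)
qed

lemma summable_partial_fractions:
  assumes "Im a \<noteq> 0"
  shows "summable (\<lambda>j. (- of_real c) ^ j / fact j / (a + of_nat j))"
  by (rule summable_comparison_test'[OF summable_divide[OF summable_exp_series]])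
     (use norm_partial_fraction_le[OF assms] in blast)

text \<open>The bound depends on \<open>a\<close> only through Im a, so it is uniform over the
  shifts a - k that occur when the half-line integral is expanded.\<close>

lemma norm_exp_partial_fractions_le:
  assumes "Im a \<noteq> 0"
  shows "cmod (exp_partial_fractions c a) \<le> exp \<bar>c\<bar> / \<bar>Im a\<bar>"
proof -
  have "cmod (exp_partial_fractions c a) \<le> (\<Sum>j. \<bar>c\<bar> ^ j / fact j / \<bar>Im a\<bar>)"
    unfolding exp_partial_fractions_def
    by (intro norm_suminf_le norm_partial_fraction_le summable_divide summable_exp_series assms)
  also have "\<dots> = exp \<bar>c\<bar> / \<bar>Im a\<bar>"
    by (subst suminf_divide[OF summable_exp_series]) (simp add: exp_def divide_inverse mult.commute)
  finally show ?thesis .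
qed

text \<open>Termwise, a / (a + j) - 1 = - j / (a + j), and the factor j lowers the factorial by one:
  the series at a + 1 reappears with its index shifted.\<close>

lemma exp_partial_fractions_step:
  assumes "Im a \<noteq> 0"
  shows "c * exp_partial_fractions c (a + 1) = a * exp_partial_fractions c a - exp (- of_real c)"
proof -
  define x where "x = (\<lambda>j. (- of_real c) ^ j / fact j :: complex)"
  have nz: "a + of_nat j \<noteq> 0" for j using assms by (auto simp: complex_eq_iff)
  have "(\<lambda>j. x j / (a + of_nat j)) sums exp_partial_fractions c a"
    unfolding x_def exp_partial_fractions_def using summable_sums[OF summable_partial_fractions[OF assms]] .
  then have "(\<lambda>j. a * (x j / (a + of_nat j))) sums (a * exp_partial_fractions c a)" by (rule sums_mult)
  moreover have "x sums exp (- of_real c)"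
    unfolding x_def using exp_converges[of "- complex_of_real c"] by (simp add: scaleR_conv_of_real field_simps)
  ultimately have "(\<lambda>j. a * (x j / (a + of_nat j)) - x j) sums (a * exp_partial_fractions c a - exp (- of_real c))"
    by (rule sums_diff)
  \<comment> \<open>The term j = 0 is a / a - 1 = 0, so dropping it leaves the sum
    unchanged.\<close>
  then have "(\<lambda>j. a * (x (Suc j) / (a + of_nat (Suc j))) - x (Suc j)) sums
      (a * exp_partial_fractions c a - exp (- of_real c))"
    using nz[of 0] by (subst sums_Suc_iff) simp
  moreover have "a * (x (Suc j) / (a + of_nat (Suc j))) - x (Suc j) = c * (x j / (a + 1 + of_nat j))" for j
  proof -
    have "a * (x (Suc j) / (a + of_nat (Suc j))) - x (Suc j) = - of_nat (Suc j) * x (Suc j) / (a + of_nat (Suc j))"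
      using nz[of "Suc j"] by (simp add: field_simps)
    also have "- of_nat (Suc j) * x (Suc j) = c * x j"
      by (simp add: x_def field_simps del: of_nat_Suc)
    finally show ?thesis by (simp add: add_ac)
  qed
  moreover have "(\<lambda>j. x j / (a + 1 + of_nat j)) sums exp_partial_fractions c (a + 1)"
    unfolding x_def exp_partial_fractions_def
    using summable_sums[OF summable_partial_fractions[of "a + 1" c]] assms by simp
  then have "(\<lambda>j. c * (x j / (a + 1 + of_nat j))) sums (c * exp_partial_fractions c (a + 1))"
    by (rule sums_mult)
  ultimately show ?thesis by (metis (no_types, lifting) sums_cong sums_unique2)
qed

text \<open>This is the expansion of the upper incomplete Gamma function; off the half-plane
  \<open>Re a > 0\<close> it is obtained from the recurrence in \<open>a\<close>, which both sides satisfy.\<close>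
lemma exp_double_exp_integral_eq:
  assumes c: "0 < c" and "Im a \<noteq> 0"
  shows "exp_double_exp_integral c a = of_real c powr (- a) * Gamma a - exp_partial_fractions c a"
proof -
  \<comment> \<open>Each induction step moves the half-plane of validity one unit to the left; every
    \<open>a\<close> lies in one of these half-planes.\<close>
  have "exp_double_exp_integral c a = of_real c powr (- a) * Gamma a - exp_partial_fractions c a"
    if "- real n < Re a" "Im a \<noteq> 0" for n a
    using that
  proof (induction n arbitrary: a)
    case 0
    let ?g = "\<lambda>u. exp (a * of_real u - of_real (c * exp u))"
    have g': "?g (- u) = exp (- (a * of_real u)) * exp (- of_real (c * exp (- u)))" for u
      by (simp flip: exp_add)
    have a: "0 < Re a" using 0 by simp
    have int: "set_integrable lborel {0<..} (\<lambda>u. exp (- (a * of_real u)))"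
      using set_integrable_power_exp_complex[OF a, of 0] by simp
    \<comment> \<open>Complete Gamma equals upper part plus lower part: u > 0 gives the former, and
      reflecting u < 0 gives an integral that expands into the partial fraction series.\<close>
    have "of_real c powr (- a) * Gamma a = exp_double_exp_integral c a + (LINT u:{0<..}|lborel. ?g (- u))"
      unfolding exp_double_exp_integral_def exp_double_exp_integral_whole_line[OF a c, symmetric]
      by (rule integral_split_at_0(2)[OF set_integrable_exp_double_exp[OF c]])
         (use sums_set_integral_exp_exp_minus(2)[OF int c] in \<open>simp only: g'\<close>)
    moreover have "(LINT u:{0<..}|lborel. ?g (- u)) = exp_partial_fractions c a"
    proof -
      have "(LINT u:{0<..}|lborel. exp (- (a * of_real u)) * exp (- (of_nat k * of_real u))) = 1 / (a + of_nat k)" for k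
        using laplace_power[of "a + of_nat k" 0] a by (simp add: algebra_simps flip: exp_add)
      then show ?thesis
        using sums_set_integral_exp_exp_minus(1)[OF int c]
        unfolding g' exp_partial_fractions_def by (simp add: sums_iff)
    qed
    ultimately show ?case by simp
  next
    case (Suc n)
    let ?R = "\<lambda>a. of_real c powr (- a) * Gamma a - exp_partial_fractions c a"
    have a0: "a \<noteq> 0" and a1: "a \<notin> \<int>\<^sub>\<le>\<^sub>0" using Suc.prems(2) by (auto elim!: nonpos_Ints_cases)
    have "exp_double_exp_integral c (a + 1) = ?R (a + 1)"
      using Suc.prems by (intro Suc.IH) auto
    then have "exp (- of_real c) + a * exp_double_exp_integral c a = c * ?R (a + 1)"
      using exp_double_exp_integral_step[OF c, of a] by simp
    also have "\<dots> = of_real c powr (- a) * (a * Gamma a) - c * exp_partial_fractions c (a + 1)"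
      using c Gamma_plus1[OF a1] powr_add[of "of_real c" 1 "- (a + 1)"] by (simp add: algebra_simps)
    also have "\<dots> = exp (- of_real c) + a * ?R a"
      using exp_partial_fractions_step[OF Suc.prems(2), of c] by (simp add: algebra_simps)
    finally show ?case using a0 by simp
  qed
  moreover obtain n :: nat where "- Re a < n" using reals_Archimedean2 by blast
  ultimately show ?thesis using assms(2) by (metis minus_less_iff)
qed

section \<open>Modified Bessel functions of non-real order\<close>

definition bessel_I :: "complex \<Rightarrow> real \<Rightarrow> complex" where
  "bessel_I \<mu> y = of_real (y / 2) powr \<mu> * (\<Sum>k. of_real (y\<^sup>2 / 4) ^ k * rGamma (\<mu> + of_nat k + 1) / fact k)"

lemma sin_pi_times_nonzero:
  assumes "Im \<mu> \<noteq> 0" shows "sin (of_real pi * \<mu>) \<noteq> 0"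
proof
  assume "sin (of_real pi * \<mu>) = 0"
  then obtain n :: int where "of_real pi * \<mu> = of_real (n * pi)"
    unfolding Complex_Transcendental.sin_eq_0 by blast
  from arg_cong[where f = Im, OF this] show False using assms by simp
qed

text \<open>Written out, T \<mu> is the double series of x k * x j / (\<mu> - k + j). Replacing
  \<mu> by - \<mu> and exchanging k with j flips only the sign of the denominator. The exchange is
  legitimate because every denominator has modulus at least |Im \<mu>|, which makes the double
  series absolutely summable.\<close>

lemma exp_partial_fractions_antisymmetric:
  fixes c :: real and \<mu> :: complex
  assumes \<mu>: "Im \<mu> \<noteq> 0"
  defines "T \<equiv> \<lambda>\<mu>. \<Sum>k. (- of_real c) ^ k / fact k * exp_partial_fractions c (\<mu> - of_nat k)"
  shows "summable (\<lambda>k. (- of_real c) ^ k / fact k * exp_partial_fractions c (\<mu> - of_nat k))"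
    and "T (- \<mu>) = - T \<mu>"
proof -
  define x where "x = (\<lambda>k. (- of_real c) ^ k / fact k :: complex)"
  have T_x: "T = (\<lambda>\<mu>. \<Sum>k. x k * exp_partial_fractions c (\<mu> - of_nat k))" by (simp add: T_def x_def)
  have norm_x: "norm (x k) = \<bar>c\<bar> ^ k / fact k" for k
    by (simp add: x_def norm_divide norm_power)
  have summ: "summable (\<lambda>k. norm (x k * exp_partial_fractions c (\<mu> - of_nat k)))"
    if "Im \<mu> \<noteq> 0" for \<mu>
  proof (rule summable_comparison_test'[OF summable_mult2[OF summable_exp_series[of c], of "exp \<bar>c\<bar> / \<bar>Im \<mu>\<bar>"]])
    fix k
    have "norm (x k * exp_partial_fractions c (\<mu> - of_nat k)) \<le> \<bar>c\<bar> ^ k / fact k * (exp \<bar>c\<bar> / \<bar>Im \<mu>\<bar>)"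
      unfolding norm_mult norm_x
      using norm_exp_partial_fractions_le[of "\<mu> - of_nat k" c] that by (intro mult_left_mono) auto
    then show "norm (norm (x k * exp_partial_fractions c (\<mu> - of_nat k))) \<le> \<bar>c\<bar> ^ k / fact k * (exp \<bar>c\<bar> / \<bar>Im \<mu>\<bar>)"
      by simp
  qed
  show "summable (\<lambda>k. (- of_real c) ^ k / fact k * exp_partial_fractions c (\<mu> - of_nat k))"
    using summ[OF \<mu>] unfolding x_def by (rule summable_norm_cancel)
  have inner: "infsum (\<lambda>j. x k * (x j / (\<mu> - of_nat k + of_nat j))) UNIV = x k * exp_partial_fractions c (\<mu> - of_nat k)"
    if "Im \<mu> \<noteq> 0" for \<mu> k
  proof -
    have Im: "Im (\<mu> - of_nat k) \<noteq> 0" using that by simp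
    have "summable (\<lambda>j. norm (x k * (x j / (\<mu> - of_nat k + of_nat j))))"
      unfolding norm_mult x_def
      by (intro summable_mult summable_comparison_test'[OF summable_divide[OF summable_exp_series]])
         (use norm_partial_fraction_le[OF Im, of c] in simp)
    moreover have "(\<lambda>j. x k * (x j / (\<mu> - of_nat k + of_nat j))) sums (x k * exp_partial_fractions c (\<mu> - of_nat k))"
      unfolding x_def exp_partial_fractions_def
      by (intro sums_mult summable_sums summable_partial_fractions Im)
    ultimately have "((\<lambda>j. x k * (x j / (\<mu> - of_nat k + of_nat j))) has_sum (x k * exp_partial_fractions c (\<mu> - of_nat k))) UNIV"
      by (rule norm_summable_imp_has_sum)
    then show "infsum (\<lambda>j. x k * (x j / (\<mu> - of_nat k + of_nat j))) UNIV = x k * exp_partial_fractions c (\<mu> - of_nat k)"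
      by (rule infsumI)
  qed
  have T_eq: "infsum (\<lambda>k. infsum (\<lambda>j. x k * (x j / (\<mu> - of_nat k + of_nat j))) UNIV) UNIV = T \<mu>"
    if "Im \<mu> \<noteq> 0" for \<mu>
  proof -
    have "((\<lambda>k. x k * exp_partial_fractions c (\<mu> - of_nat k)) has_sum T \<mu>) UNIV"
      unfolding T_x
      by (rule norm_summable_imp_has_sum[OF summ[OF that] summable_sums[OF summable_norm_cancel[OF summ[OF that]]]])
    then show ?thesis using inner[OF that] by (simp add: infsumI)
  qed
  have double: "(\<lambda>(k, j). x k * (x j / (\<mu> - of_nat k + of_nat j))) summable_on UNIV \<times> UNIV"
  proof (rule abs_summable_summable)
    have xs: "(\<lambda>j. norm (x j)) summable_on UNIV"
      unfolding norm_x by (intro norm_summable_imp_summable_on) (simp add: summable_exp_series)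
    have "(\<lambda>(k, j). norm (x k) * norm (x j) / \<bar>Im \<mu>\<bar>) summable_on (UNIV \<times> UNIV)"
    proof (rule summable_on_SigmaI)
      fix k
      show "((\<lambda>j. case (k, j) of (k, j) \<Rightarrow> norm (x k) * norm (x j) / \<bar>Im \<mu>\<bar>) has_sum
          norm (x k) * infsum (\<lambda>j. norm (x j)) UNIV / \<bar>Im \<mu>\<bar>) UNIV"
        unfolding prod.case by (intro has_sum_divide_const has_sum_cmult_right has_sum_infsum xs)
      show "(\<lambda>k. norm (x k) * infsum (\<lambda>j. norm (x j)) UNIV / \<bar>Im \<mu>\<bar>) summable_on UNIV"
        unfolding divide_inverse by (intro summable_on_cmult_left xs)
    qed auto
    then have "(\<lambda>p. norm (case p of (k, j) \<Rightarrow> norm (x k) * norm (x j) / \<bar>Im \<mu>\<bar>)) summable_on (UNIV \<times> UNIV)"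
      by (simp add: case_prod_unfold)
    then show "(\<lambda>p. norm (case p of (k, j) \<Rightarrow> x k * (x j / (\<mu> - of_nat k + of_nat j)))) summable_on UNIV \<times> UNIV"
    proof (rule Infinite_Sum.abs_summable_on_comparison_test)
      fix p :: "nat \<times> nat"
      obtain k j where p: "p = (k, j)" by (cases p)
      have "0 < \<bar>Im \<mu>\<bar>" "\<bar>Im \<mu>\<bar> \<le> cmod (\<mu> - of_nat k + of_nat j)"
        using \<mu> norm_add_of_nat_ge[of "\<mu> - of_nat k" j] by auto
      then have "norm (x k) * norm (x j) / norm (\<mu> - of_nat k + of_nat j) \<le> norm (x k) * norm (x j) / \<bar>Im \<mu>\<bar>"
        by (intro divide_left_mono mult_pos_pos mult_nonneg_nonneg; force)
      then show "norm (case p of (k, j) \<Rightarrow> x k * (x j / (\<mu> - of_nat k + of_nat j)))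
          \<le> norm (case p of (k, j) \<Rightarrow> norm (x k) * norm (x j) / \<bar>Im \<mu>\<bar>)"
        by (simp add: p norm_mult norm_divide)
    qed
  qed
  have "T (- \<mu>) = infsum (\<lambda>k. infsum (\<lambda>j. x k * (x j / (- \<mu> - of_nat k + of_nat j))) UNIV) UNIV"
    using T_eq[of "- \<mu>"] \<mu> by simp
  also have "\<dots> = infsum (\<lambda>k. infsum (\<lambda>j. - (x j * (x k / (\<mu> - of_nat j + of_nat k)))) UNIV) UNIV"
  proof (intro infsum_cong)
    fix k j :: nat
    have "\<mu> - of_nat j + of_nat k \<noteq> 0" "- \<mu> - of_nat k + of_nat j \<noteq> 0"
      using \<mu> by (auto simp: complex_eq_iff)
    then show "x k * (x j / (- \<mu> - of_nat k + of_nat j)) = - (x j * (x k / (\<mu> - of_nat j + of_nat k)))"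
      by (simp add: divide_simps) (simp add: algebra_simps)
  qed
  also have "\<dots> = - infsum (\<lambda>k. infsum (\<lambda>j. x j * (x k / (\<mu> - of_nat j + of_nat k))) UNIV) UNIV"
    by (simp add: infsum_uminus)
  also have "infsum (\<lambda>k. infsum (\<lambda>j. x j * (x k / (\<mu> - of_nat j + of_nat k))) UNIV) UNIV =
      infsum (\<lambda>k. infsum (\<lambda>j. x k * (x j / (\<mu> - of_nat k + of_nat j))) UNIV) UNIV"
    by (rule infsum_swap_banach[OF double, symmetric])
  also have "\<dots> = T \<mu>" by (rule T_eq[OF \<mu>])
  finally show "T (- \<mu>) = - T \<mu>" .
qed

text \<open>With c = y / 2, y cosh u = c exp u + c exp (- u). Expanding exp (- c exp (- u)) produces
  the incomplete Gamma integral at \<mu> - k; its complete Gamma part gives the k-th term of the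
  series of \<open>bessel_I (- \<mu>)\<close>, its lower part the double series that is odd in
  \<mu>.\<close>

lemma bessel_half_integral:
  assumes y: "0 < y" and \<mu>: "Im \<mu> \<noteq> 0"
  shows "set_integrable lborel {0<..} (\<lambda>u. exp (\<mu> * of_real u - of_real (y * cosh u)))"
    and "(LINT u:{0<..}|lborel. exp (\<mu> * of_real u - of_real (y * cosh u))) =
      of_real pi / sin (of_real pi * \<mu>) * bessel_I (- \<mu>) y -
      (\<Sum>k. (- of_real (y / 2)) ^ k / fact k * exp_partial_fractions (y / 2) (\<mu> - of_nat k))"
proof -
  define c where "c = y / 2"
  have c: "0 < c" using y by (simp add: c_def)
  let ?g = "\<lambda>u. exp (\<mu> * of_real u - of_real (c * exp u))"
  have g: "set_integrable lborel {0<..} ?g" by (rule set_integrable_exp_double_exp[OF c])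
  have eq: "?g u * exp (- of_real (c * exp (- u))) = exp (\<mu> * of_real u - of_real (y * cosh u))" for u
    by (simp add: c_def cosh_def algebra_simps flip: exp_add)
  show "set_integrable lborel {0<..} (\<lambda>u. exp (\<mu> * of_real u - of_real (y * cosh u)))"
    using sums_set_integral_exp_exp_minus(2)[OF g c] unfolding eq .
  define x where "x = (\<lambda>k. (- of_real c) ^ k / fact k :: complex)"
  define P where "P = (\<lambda>k. of_real pi / sin (of_real pi * \<mu>) * of_real c powr (- \<mu>) *
      (of_real (y\<^sup>2 / 4) ^ k * rGamma (- \<mu> + of_nat k + 1) / fact k))"
  have sin_nz: "sin (of_real pi * \<mu>) \<noteq> 0"
    by (rule sin_pi_times_nonzero[OF \<mu>])
  have term_eq: "x k * (LINT u:{0<..}|lborel. ?g u * exp (- (of_nat k * of_real u))) =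
      P k - x k * exp_partial_fractions c (\<mu> - of_nat k)" for k
  proof -
    have "?g u * exp (- (of_nat k * of_real u)) = exp ((\<mu> - of_nat k) * of_real u - of_real (c * exp u))" for u
      by (simp add: algebra_simps flip: exp_add)
    then have "(LINT u:{0<..}|lborel. ?g u * exp (- (of_nat k * of_real u))) = exp_double_exp_integral c (\<mu> - of_nat k)"
      by (simp add: exp_double_exp_integral_def)
    also have "\<dots> = of_real c powr (of_nat k - \<mu>) * Gamma (\<mu> - of_nat k) - exp_partial_fractions c (\<mu> - of_nat k)"
      using exp_double_exp_integral_eq[OF c, of "\<mu> - of_nat k"] \<mu> by simp
    finally have 1: "(LINT u:{0<..}|lborel. ?g u * exp (- (of_nat k * of_real u))) = \<dots>" .
    have powr_eq: "of_real c powr (of_nat k - \<mu>) = of_real c powr (- \<mu>) * of_real c ^ k"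
      using c by (simp add: powr_diff powr_minus divide_inverse powr_nat mult.commute)
    \<comment> \<open>Gamma reflection turns the descending arguments \<mu> - k into the reciprocal
      Gamma factors of a Bessel series; the sign (-1)^k later cancels that of (- c)^k.\<close>
    have Gamma_eq: "Gamma (\<mu> - of_nat k) = (-1) ^ k * of_real pi / sin (of_real pi * \<mu>) * rGamma (- \<mu> + of_nat k + 1)"
    proof -
      have "sin (of_real pi * (\<mu> - of_nat k)) = (-1) ^ k * sin (of_real pi * \<mu>)"
      proof -
        have "sin (of_real pi * of_nat k :: complex) = 0"
          by (metis mult.commute of_real_0 of_real_mult of_real_of_nat_eq sin_npi sin_of_real)
        moreover have "cos (of_real pi * of_nat k :: complex) = (-1) ^ k"
          by (metis mult.commute of_real_1 of_real_minus of_real_mult of_real_of_nat_eq of_real_power cos_npi cos_of_real)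
        ultimately show ?thesis by (simp add: right_diff_distrib sin_diff)
      qed
      then have "Gamma (\<mu> - of_nat k) * Gamma (- \<mu> + of_nat k + 1) = (-1) ^ k * of_real pi / sin (of_real pi * \<mu>)"
        using Gamma_reflection_complex[of "\<mu> - of_nat k"] by (cases "even k") (simp_all add: algebra_simps)
      moreover have "Gamma (- \<mu> + of_nat k + 1) \<noteq> 0"
      proof -
        have "- \<mu> + of_nat k + 1 \<notin> \<int>\<^sub>\<le>\<^sub>0"
        proof
          assume "- \<mu> + of_nat k + 1 \<in> \<int>\<^sub>\<le>\<^sub>0"
          then obtain n where "- \<mu> + of_nat k + 1 = of_int n" by (auto elim: nonpos_Ints_cases)
          from arg_cong[where f = Im, OF this] show False using \<mu> by simp
        qed
        then show ?thesis by (simp only: Gamma_eq_zero_iff) simp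
      qed
      ultimately show ?thesis
        by (simp only: rGamma_inverse_Gamma divide_inverse[symmetric, of _ "Gamma _"] eq_divide_eq) simp
    qed
    have power_eq: "x k * of_real c ^ k * (-1) ^ k = of_real (y\<^sup>2 / 4) ^ k / fact k"
    proof -
      have "(- of_real c) ^ k * of_real c ^ k * (-1) ^ k = ((- of_real c) * of_real c * (-1) :: complex) ^ k"
        by (simp only: power_mult_distrib)
      also have "(- of_real c) * of_real c * (-1) = (of_real (y\<^sup>2 / 4) :: complex)"
        by (simp add: c_def power2_eq_square)
      finally show ?thesis by (simp only: x_def times_divide_eq_left)
    qed
    have "x k * (of_real c powr (of_nat k - \<mu>) * Gamma (\<mu> - of_nat k)) =
        of_real pi / sin (of_real pi * \<mu>) * of_real c powr (- \<mu>) *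
          (x k * of_real c ^ k * (-1) ^ k * rGamma (- \<mu> + of_nat k + 1))"
      unfolding powr_eq Gamma_eq by (simp only: divide_inverse mult_ac)
    also have "\<dots> = P k"
      unfolding power_eq P_def by (simp only: times_divide_eq_left times_divide_eq_right)
    finally have "x k * (of_real c powr (of_nat k - \<mu>) * Gamma (\<mu> - of_nat k)) = P k" .
    then show ?thesis unfolding 1 by (simp add: right_diff_distrib)
  qed
  have "(\<lambda>k. x k * (LINT u:{0<..}|lborel. ?g u * exp (- (of_nat k * of_real u)))) sums
      (LINT u:{0<..}|lborel. exp (\<mu> * of_real u - of_real (y * cosh u)))"
    using sums_set_integral_exp_exp_minus(1)[OF g c] unfolding eq x_def .
  then have sums: "(\<lambda>k. P k - x k * exp_partial_fractions c (\<mu> - of_nat k)) sums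
      (LINT u:{0<..}|lborel. exp (\<mu> * of_real u - of_real (y * cosh u)))"
    unfolding term_eq .
  have summ: "summable (\<lambda>k. x k * exp_partial_fractions c (\<mu> - of_nat k))"
    unfolding x_def by (rule exp_partial_fractions_antisymmetric(1)[OF \<mu>])
  from sums_add[OF sums summable_sums[OF this]]
  have P_sums: "P sums ((LINT u:{0<..}|lborel. exp (\<mu> * of_real u - of_real (y * cosh u))) +
      (\<Sum>k. x k * exp_partial_fractions c (\<mu> - of_nat k)))" by simp
  have "(\<Sum>k. P k) = of_real pi / sin (of_real pi * \<mu>) * bessel_I (- \<mu>) y"
  proof -
    have nz: "of_real pi / sin (of_real pi * \<mu>) * of_real c powr (- \<mu>) \<noteq> 0"
      using sin_nz c by (simp add: powr_def)
    \<comment> \<open>Convergence of the Bessel series is inherited from \<open>P_sums\<close> by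
      dividing out the nonzero prefactor.\<close>
    have "summable (\<lambda>k. of_real (y\<^sup>2 / 4) ^ k * rGamma (- \<mu> + of_nat k + 1) / fact k)"
      by (rule summable_mult_D[OF _ nz]) (rule sums_summable[OF P_sums[unfolded P_def]])
    then show ?thesis unfolding P_def bessel_I_def c_def by (subst suminf_mult) auto
  qed
  then show "(LINT u:{0<..}|lborel. exp (\<mu> * of_real u - of_real (y * cosh u))) =
      of_real pi / sin (of_real pi * \<mu>) * bessel_I (- \<mu>) y -
      (\<Sum>k. (- of_real (y / 2)) ^ k / fact k * exp_partial_fractions (y / 2) (\<mu> - of_nat k))"
    using P_sums unfolding x_def c_def by (simp add: sums_iff)
qed

text \<open>The half-lines contribute the same formula at \<mu> and at - \<mu>; the sine and the
  double series are both odd, so the latter drops out. The value is twice the modified Bessel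
  function K of order \<mu> at y.\<close>

lemma bessel_K_integral:
  assumes y: "0 < y" and \<mu>: "Im \<mu> \<noteq> 0"
  shows "integrable lborel (\<lambda>u. exp (\<mu> * of_real u - of_real (y * cosh u)))"
    and "(\<integral>u. exp (\<mu> * of_real u - of_real (y * cosh u)) \<partial>lborel) =
      of_real pi / sin (of_real pi * \<mu>) * (bessel_I (- \<mu>) y - bessel_I \<mu> y)"
proof -
  let ?f = "\<lambda>\<mu> u. exp (\<mu> * of_real u - of_real (y * cosh u))"
  have neg: "?f \<mu> (- u) = ?f (- \<mu>) u" for u by simp
  have \<mu>': "Im (- \<mu>) \<noteq> 0" using \<mu> by simp
  note pos_int = bessel_half_integral(1)[OF y \<mu>] and neg_int = bessel_half_integral(1)[OF y \<mu>']
  show "integrable lborel (?f \<mu>)"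
    by (rule integral_split_at_0(1)[OF pos_int]) (simp only: neg neg_int)
  have "(\<integral>u. ?f \<mu> u \<partial>lborel) = (LINT u:{0<..}|lborel. ?f \<mu> u) + (LINT u:{0<..}|lborel. ?f (- \<mu>) u)"
    using integral_split_at_0(2)[OF pos_int] neg_int unfolding neg by blast
  also have "\<dots> = of_real pi / sin (of_real pi * \<mu>) * (bessel_I (- \<mu>) y - bessel_I \<mu> y)"
    unfolding bessel_half_integral(2)[OF y \<mu>] bessel_half_integral(2)[OF y \<mu>']
      exp_partial_fractions_antisymmetric(2)[OF \<mu>]
    by (simp add: right_diff_distrib)
  finally show "(\<integral>u. ?f \<mu> u \<partial>lborel) =
      of_real pi / sin (of_real pi * \<mu>) * (bessel_I (- \<mu>) y - bessel_I \<mu> y)" .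
qed

text \<open>The principal argument of \<i> y is pi / 2, which gives the exponential factor; squaring
  \<i> cancels the alternating signs of the series.\<close>

lemma bessel_J_imaginary:
  assumes "0 < y"
  shows "bessel_J \<mu> (\<i> * of_real y) = exp (\<i> * of_real pi * \<mu> / 2) * bessel_I \<mu> y"
proof -
  have "Ln (\<i> * of_real y / 2) = \<i> * of_real pi / 2 + Ln (of_real (y / 2))"
  proof -
    have "Ln (of_real (y / 2) * \<i>) = of_real (ln (y / 2)) + Ln \<i>"
      using Ln_times_of_real[of "y / 2" \<i>] Ln_of_real[of "y / 2"] assms by (simp del: of_real_divide)
    moreover have "Ln (of_real (y / 2)) = of_real (ln (y / 2))"
      using assms by (intro Ln_of_real) auto
    moreover have "\<i> * of_real y / 2 = of_real (y / 2) * \<i>" by simp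
    ultimately show ?thesis by (simp only: Ln_ii add.commute)
  qed
  then have "(\<i> * of_real y / 2) powr \<mu> = exp (\<i> * of_real pi * \<mu> / 2) * of_real (y / 2) powr \<mu>"
    using assms by (simp add: powr_def algebra_simps flip: exp_add)
  moreover have "(-1) ^ k * ((\<i> * of_real y)\<^sup>2 / 4) ^ k = (of_real (y\<^sup>2 / 4) ^ k :: complex)" for k
  proof -
    have "(-1) ^ k * ((\<i> * of_real y)\<^sup>2 / 4) ^ k = ((-1) * ((\<i> * of_real y)\<^sup>2 / 4)) ^ k"
      by (simp only: power_mult_distrib)
    also have "(-1) * ((\<i> * of_real y)\<^sup>2 / 4) = of_real (y\<^sup>2 / 4)"
      by (simp add: power_mult_distrib)
    finally show ?thesis .
  qed
  ultimately show ?thesis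
    unfolding bessel_J_def bessel_I_def by (simp only: mult.assoc)
qed

lemma hankel_H1_imaginary:
  assumes y: "0 < y" and \<mu>: "Im \<mu> \<noteq> 0"
  shows "\<i> * hankel_H1 \<mu> (\<i> * of_real y) =
    exp (- (\<i> * of_real pi * \<mu> / 2)) / of_real pi * (\<integral>u. exp (\<mu> * of_real u - of_real (y * cosh u)) \<partial>lborel)"
proof -
  define e where "e = exp (\<i> * of_real pi * \<mu> / 2)"
  have e0: "e \<noteq> 0" by (simp add: e_def)
  have e1: "exp (- (\<i> * of_real pi * \<mu> / 2)) = 1 / e" by (simp only: e_def exp_minus inverse_eq_divide)
  have "e * e = exp (\<i> * (of_real pi * \<mu>))"
    by (simp add: e_def mult_exp_exp mult_ac)
  then have e2: "cos (of_real pi * \<mu>) - \<i> * sin (of_real pi * \<mu>) = 1 / (e * e)"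
    by (simp only: exp_minus_Euler[symmetric] exp_minus inverse_eq_divide)
  \<comment> \<open>The order is not real, so \<open>bessel_Y\<close> is the plain quotient and its
    limit at integer orders does not arise.\<close>
  have "\<mu> \<notin> \<int>" using \<mu> by (auto elim!: Ints_cases)
  note sin_nz = sin_pi_times_nonzero[OF \<mu>]
  have "exp (\<i> * of_real pi * (- \<mu>) / 2) = 1 / e"
    by (simp only: e1[symmetric] mult_minus_right minus_divide_left)
  then have J: "bessel_J \<mu> (\<i> * of_real y) = e * bessel_I \<mu> y"
    "bessel_J (- \<mu>) (\<i> * of_real y) = 1 / e * bessel_I (- \<mu>) y"
    by (simp_all only: bessel_J_imaginary[OF y] e_def)
  \<comment> \<open>Eliminates Y: \<i> H is the difference of J at order - \<mu> and exp (- \<i> pi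
    \<mu>) times J at order \<mu>, divided by sin (pi \<mu>).\<close>
  have alg: "\<i> * (a + \<i> * ((a * c - b) / s)) = (b - (c - \<i> * s) * a) / s" if "s \<noteq> 0" for a b c s :: complex
    using that by (simp add: field_simps)
  have "\<i> * hankel_H1 \<mu> (\<i> * of_real y) =
      (bessel_J (- \<mu>) (\<i> * of_real y) - 1 / (e * e) * bessel_J \<mu> (\<i> * of_real y)) / sin (of_real pi * \<mu>)"
    unfolding hankel_H1_def bessel_Y_def bessel_Y_generic_def if_not_P[OF \<open>\<mu> \<notin> \<int>\<close>] alg[OF sin_nz] e2 ..
  also have "\<dots> = 1 / e / of_real pi * (of_real pi / sin (of_real pi * \<mu>) * (bessel_I (- \<mu>) y - bessel_I \<mu> y))"
    unfolding J using e0 sin_nz by (simp add: field_simps)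
  finally show ?thesis unfolding e1 bessel_K_integral(2)[OF y \<mu>] .
qed

section \<open>Residues in a horizontal strip\<close>

lemma sinh_Complex: "sinh (Complex x y) = Complex (sinh x * cos y) (cosh x * sin y)"
proof (rule complex_eqI)
  have e: "exp (Complex x y) = of_real (exp x) * cis y" "exp (- Complex x y) = of_real (exp (- x)) * cis (- y)"
    by (simp_all add: exp_eq_polar)
  show "Re (sinh (Complex x y)) = Re (Complex (sinh x * cos y) (cosh x * sin y))"
    "Im (sinh (Complex x y)) = Im (Complex (sinh x * cos y) (cosh x * sin y))"
    unfolding sinh_field_def cosh_field_def e by (simp_all add: algebra_simps)
qed

lemma cosh_Complex: "cosh (Complex x y) = Complex (cosh x * cos y) (sinh x * sin y)"
proof (rule complex_eqI)
  have e: "exp (Complex x y) = of_real (exp x) * cis y" "exp (- Complex x y) = of_real (exp (- x)) * cis (- y)"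
    by (simp_all add: exp_eq_polar)
  show "Re (cosh (Complex x y)) = Re (Complex (cosh x * cos y) (sinh x * sin y))"
    "Im (cosh (Complex x y)) = Im (Complex (cosh x * cos y) (sinh x * sin y))"
    unfolding sinh_field_def cosh_field_def e by (simp_all add: algebra_simps)
qed

lemma cosh_of_real_complex: "cosh (of_real x) = (of_real (cosh x) :: complex)"
  using cosh_Complex[of x 0] by (simp add: complex_of_real_def)

text \<open>1 / cosh serves below as the common integrable majorant on the lines Im z = \<gamma> and
  Im z = - \<gamma>.\<close>

lemma integrable_inverse_cosh: "integrable lborel (\<lambda>x::real. 1 / cosh x)"
proof (rule integral_split_at_0(1))
  show "set_integrable lborel {0<..} (\<lambda>x::real. 1 / cosh x)"
  proof (rule set_integrable_bound)
    show "set_integrable lborel {0<..} (\<lambda>x::real. 2 * exp (- (1 * x)))"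
      by (intro set_integrable_mult_right set_integrable_exp_decay) auto
    have "1 / cosh x \<le> 2 * exp (- x)" for x :: real
    proof -
      have "exp x / 2 \<le> cosh x" by (simp add: cosh_field_def)
      then have "1 / cosh x \<le> 1 / (exp x / 2)" by (intro divide_left_mono) auto
      then show ?thesis by (simp add: exp_minus field_simps)
    qed
    then show "AE x::real in lborel. x \<in> {0<..} \<longrightarrow> norm (1 / cosh x) \<le> norm (2 * exp (- (1 * x)))"
      by simp
  qed (auto simp: set_borel_measurable_def cosh_field_def)
  then show "set_integrable lborel {0<..} (\<lambda>x::real. 1 / cosh (- x))" by simp
qed

text \<open>Residues produce complex derivatives, whereas the coefficients are defined by iterated
  real ones. At each order the complex derivative along the reals differentiates a real-valued
  function, so its imaginary part vanishes.\<close>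

lemma higher_deriv_of_real:
  fixes f :: "real \<Rightarrow> real"
  assumes F: "F holomorphic_on S" and S: "open S" "\<And>x. of_real x \<in> S"
    and eq: "\<And>x. F (of_real x) = of_real (f x)"
  shows "(deriv ^^ k) F (of_real x) = of_real ((deriv ^^ k) f x)"
proof (induction k arbitrary: x)
  case 0
  show ?case using eq by simp
next
  case (Suc k)
  define D where "D = (deriv ^^ Suc k) F (of_real x)"
  have "((deriv ^^ k) F has_field_derivative D) (at (of_real x))"
    using holomorphic_derivI[OF holomorphic_higher_deriv[OF F S(1)] S(1) S(2)] by (simp add: D_def)
  then have vd: "((\<lambda>t. of_real ((deriv ^^ k) f t)) has_vector_derivative D) (at x)"
    using has_vector_derivative_real_field[of "(deriv ^^ k) F" D x UNIV] Suc.IH by simp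
  have "((\<lambda>t. Re (of_real ((deriv ^^ k) f t))) has_vector_derivative Re D) (at x)"
    "((\<lambda>t. Im (of_real ((deriv ^^ k) f t))) has_vector_derivative Im D) (at x)"
    using vd by (rule bounded_linear.has_vector_derivative[OF bounded_linear_Re],
        rule bounded_linear.has_vector_derivative[OF bounded_linear_Im])
  then have re: "((deriv ^^ k) f has_real_derivative Re D) (at x)"
    and im: "((\<lambda>t. 0) has_real_derivative Im D) (at x)"
    by (simp_all add: has_real_derivative_iff_has_vector_derivative)
  have "Im D = 0" using DERIV_unique[OF im DERIV_const] .
  moreover have "(deriv ^^ Suc k) f x = Re D" using DERIV_imp_deriv[OF re] by simp
  ultimately show ?case unfolding D_def[symmetric] by (simp add: complex_eq_iff)
qed

section \<open>The phase h in the strip of half-width \<beta>\<close>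

text \<open>\<gamma> is the height of the line of integration and \<beta> that of the strip; the
  strict inequality keeps both lines inside an open set where h - hr x vanishes only at x.\<close>

locale sinh_phase =
  fixes \<beta> \<gamma> :: real
  assumes \<gamma>_pos: "0 < \<gamma>" and \<gamma>_less: "\<gamma> < \<beta>" and \<beta>_less: "\<beta> < pi / 2"
begin

definition s :: real where "s = sec \<beta>"
definition h :: "complex \<Rightarrow> complex" where "h z = of_real s * sinh z - z"
definition hr :: "real \<Rightarrow> real" where "hr x = s * sinh x - x"
text \<open>The minimum of Im h on the line Im z = \<gamma>, attained at \<i> \<gamma>.\<close>

definition \<delta> :: real where "\<delta> = s * sin \<gamma> - \<gamma>"
definition strip :: "complex set" where "strip = {z. - \<beta> < Im z \<and> Im z < \<beta>}"

lemma s_gt_1: "1 < s"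
proof -
  have "0 < cos \<beta>" using \<gamma>_pos \<gamma>_less \<beta>_less by (intro cos_gt_zero_pi) auto
  moreover have "cos \<beta> < cos 0" using \<gamma>_pos \<gamma>_less \<beta>_less by (intro cos_monotone_0_pi) auto
  ultimately show ?thesis by (simp add: s_def sec_def)
qed

lemma s_cos_gt_1: assumes "\<bar>y\<bar> < \<beta>" shows "1 < s * cos y"
proof -
  have "0 < cos \<beta>" using \<gamma>_pos \<gamma>_less \<beta>_less by (intro cos_gt_zero_pi) auto
  moreover have "cos \<beta> < cos \<bar>y\<bar>" using assms \<beta>_less by (intro cos_monotone_0_pi) auto
  ultimately show ?thesis by (simp add: s_def sec_def)
qed

text \<open>Below \<beta>, 1 / cos y stays under s = 1 / cos \<beta>; multiplying by sin y and using
  y \<le> tan y gives the claim. It is what keeps Im h away from 0 off the real axis.\<close>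

lemma s_sin_gt: assumes "0 < y" "y < \<beta>" shows "y < s * sin y"
proof -
  have "0 < cos y" using assms \<beta>_less by (intro cos_gt_zero_pi) auto
  have "y \<le> tan y"
    using abs_tan_ge[of y] tan_gt_zero[of y] assms \<beta>_less by auto
  also have "\<dots> < s * sin y"
  proof -
    have "1 / cos y < s" using s_cos_gt_1[of y] assms \<open>0 < cos y\<close> by (simp add: divide_less_eq)
    moreover have "0 < sin y" using assms \<beta>_less by (intro sin_gt_zero) auto
    ultimately have "1 / cos y * sin y < s * sin y" by (intro mult_strict_right_mono)
    then show ?thesis by (simp add: tan_def)
  qed
  finally show ?thesis .
qed

lemma \<delta>_pos: "0 < \<delta>"
  unfolding \<delta>_def using s_sin_gt[of \<gamma>] \<gamma>_pos \<gamma>_less by simp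

lemma Re_h: "Re (h (Complex x y)) = s * sinh x * cos y - x"
  and Im_h: "Im (h (Complex x y)) = s * cosh x * sin y - y"
  by (simp_all add: h_def sinh_Complex)

lemma h_of_real: "h (of_real x) = of_real (hr x)"
  using Re_h[of x 0] Im_h[of x 0] by (simp add: complex_eq_iff hr_def complex_of_real_def)

lemma h_minus: "h (- z) = - h z" by (simp add: h_def)

lemma h_0: "h 0 = 0" by (simp add: h_def)

lemma h_deriv: "(h has_field_derivative of_real s * cosh z - 1) (at z)"
  unfolding h_def [abs_def] by (auto intro!: derivative_eq_intros)

lemma h_holomorphic: "h holomorphic_on A"
  using h_deriv by (meson holomorphic_on_def field_differentiable_at_within field_differentiable_def)

lemma h_continuous: "continuous_on A h"
  by (intro holomorphic_on_imp_continuous_on h_holomorphic)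

lemma hr_deriv: "(hr has_real_derivative s * cosh x - 1) (at x)"
  unfolding hr_def [abs_def] by (auto intro!: derivative_eq_intros)

lemma hr_deriv_pos: "0 < s * cosh x - 1"
  using mult_less_le_imp_less[of 1 s 1 "cosh x"] s_gt_1 cosh_real_ge_1[of x] by simp

lemma hr_strict_mono: "strict_mono hr"
proof (rule strict_monoI)
  fix x y :: real assume "x < y"
  then show "hr x < hr y"
    by (rule DERIV_pos_imp_increasing) (use hr_deriv hr_deriv_pos in blast)
qed

lemma hr_eq_iff: "hr x = hr y \<longleftrightarrow> x = y"
  using hr_strict_mono by (simp add: strict_mono_eq)

text \<open>A real value at u + \<i> y means s cosh u sin y = y. For 0 < |y| < \<beta> the left side
  exceeds y in modulus, since s sin |y| > |y| and cosh u \<ge> 1.\<close>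

lemma h_eq_real_iff:
  assumes "z \<in> strip" shows "h z = of_real (hr x) \<longleftrightarrow> z = of_real x"
proof
  assume eq: "h z = of_real (hr x)"
  obtain u y where z: "z = Complex u y" by (cases z)
  have y: "\<bar>y\<bar> < \<beta>" using assms by (auto simp: strip_def z)
  have Im0: "s * cosh u * sin y = y" using eq Im_h[of u y] by (simp add: z)
  have "y = 0"
  proof (rule ccontr)
    assume "y \<noteq> 0"
    then have "\<bar>y\<bar> < s * sin \<bar>y\<bar>" using y by (intro s_sin_gt) auto
    also have "\<dots> \<le> cosh u * (s * sin \<bar>y\<bar>)"
      using \<open>\<bar>y\<bar> < s * sin \<bar>y\<bar>\<close> cosh_real_ge_1[of u] mult_right_mono[of 1 "cosh u" "s * sin \<bar>y\<bar>"] by auto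
    also have "\<dots> = \<bar>y\<bar>" using Im0 by (cases "0 \<le> y") (auto simp: algebra_simps)
    finally show False by simp
  qed
  then have "z = of_real u" by (simp add: z complex_of_real_def)
  then show "z = of_real x" using eq by (simp add: h_of_real hr_eq_iff)
qed (simp add: h_of_real)

lemma Im_h_ge: "\<delta> * cosh x \<le> \<bar>Im (h (Complex x \<gamma>))\<bar>" "\<delta> * cosh x \<le> - Im (h (Complex x (- \<gamma>)))"
proof -
  have "\<gamma> * 1 \<le> \<gamma> * cosh x" using \<gamma>_pos cosh_real_ge_1[of x] by (intro mult_left_mono) auto
  then have "\<delta> * cosh x \<le> s * cosh x * sin \<gamma> - \<gamma>" by (simp add: \<delta>_def algebra_simps)
  then show "\<delta> * cosh x \<le> \<bar>Im (h (Complex x \<gamma>))\<bar>" "\<delta> * cosh x \<le> - Im (h (Complex x (- \<gamma>)))"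
    unfolding Im_h by auto
qed

text \<open>On vertical segments between the two lines Im h may vanish, so the growth is taken from
  Re h: s cos y > 1 lets sinh win uniformly in y.\<close>

lemma norm_h_ge:
  assumes "\<bar>y\<bar> \<le> \<gamma>"
  shows "sinh \<bar>x\<bar> - \<bar>x\<bar> - \<bar>r\<bar> \<le> cmod (h (Complex x y) - of_real r)"
proof -
  have 1: "1 < s * cos y" using assms \<gamma>_less by (intro s_cos_gt_1) auto
  have "\<bar>sinh x\<bar> * 1 \<le> \<bar>sinh x\<bar> * \<bar>s * cos y\<bar>" using 1 by (intro mult_left_mono) auto
  then have "sinh \<bar>x\<bar> \<le> \<bar>s * sinh x * cos y\<bar>"
    by (simp add: abs_mult mult_ac)
  then have "sinh \<bar>x\<bar> - \<bar>x\<bar> - \<bar>r\<bar> \<le> \<bar>s * sinh x * cos y - x - r\<bar>" by linarith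
  also have "\<dots> = \<bar>Re (h (Complex x y) - of_real r)\<bar>" by (simp add: Re_h)
  also have "\<dots> \<le> cmod (h (Complex x y) - of_real r)" by (rule abs_Re_le_cmod)
  finally show ?thesis .
qed

lemma borel_measurable_h_line: "(\<lambda>u. h (Complex u y)) \<in> borel_measurable borel"
  by (intro borel_measurable_continuous_onI continuous_on_compose2[OF h_continuous[of UNIV]])
     (auto simp: Complex_eq intro!: continuous_intros)

section \<open>Line integrals of inverse powers of h by residues\<close>

lemma integrable_inverse_h_power:
  assumes "\<bar>y\<bar> = \<gamma>" "0 < m"
  shows "integrable lborel (\<lambda>u. 1 / (h (Complex u y) - of_real r) ^ m)"
proof (rule Bochner_Integration.integrable_bound)
  show "integrable lborel (\<lambda>u. 1 / \<delta> ^ m * (1 / cosh u))"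
    by (intro integrable_mult_right integrable_inverse_cosh)
  show "(\<lambda>u. 1 / (h (Complex u y) - of_real r) ^ m) \<in> borel_measurable lborel"
    using borel_measurable_h_line[of y] by measurable
  have "cmod (1 / (h (Complex u y) - of_real r) ^ m) \<le> 1 / \<delta> ^ m * (1 / cosh u)" for u
  proof -
    \<comment> \<open>Subtracting the real number r leaves the imaginary part alone, so the bound is
      independent of r.\<close>
    have "\<delta> * cosh u \<le> \<bar>Im (h (Complex u y))\<bar>"
      using Im_h_ge[of u] assms(1) by (cases "y = \<gamma>") (auto simp: abs_if split: if_splits)
    also have "\<dots> \<le> cmod (h (Complex u y) - of_real r)"
      using abs_Im_le_cmod[of "h (Complex u y) - of_real r"] by simp
    finally have "(\<delta> * cosh u) ^ m \<le> cmod ((h (Complex u y) - of_real r) ^ m)"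
      using \<delta>_pos by (simp add: norm_power power_mono)
    moreover have "\<delta> ^ m * cosh u \<le> (\<delta> * cosh u) ^ m"
      using \<delta>_pos assms(2) cosh_real_ge_1[of u] self_le_power[of "cosh u" m]
      by (simp add: power_mult_distrib)
    moreover have "0 < \<delta> ^ m * cosh u" using \<delta>_pos by simp
    ultimately have "1 / cmod ((h (Complex u y) - of_real r) ^ m) \<le> 1 / (\<delta> ^ m * cosh u)"
      by (intro frac_le; linarith)
    then show ?thesis by (simp add: norm_divide)
  qed
  then show "AE u in lborel. norm (1 / (h (Complex u y) - of_real r) ^ m) \<le> norm (1 / \<delta> ^ m * (1 / cosh u))"
    using \<delta>_pos by simp
qed

lemma strip_integral_inverse_h:
  assumes m: "0 < m"
  shows "(\<integral>u. 1 / (h (Complex u (- \<gamma>)) - of_real (hr x)) ^ m \<partial>lborel) -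
      (\<integral>u. 1 / (h (Complex u \<gamma>) - of_real (hr x)) ^ m \<partial>lborel) =
      2 * pi * \<i> * residue (\<lambda>z. 1 / (h z - of_real (hr x)) ^ m) (of_real x)"
proof -
  let ?D = "\<lambda>u. sinh u - u - \<bar>hr x\<bar>"
  have D: "filterlim ?D at_top at_top"
    unfolding sinh_field_def by real_asymp
  then obtain X where X: "\<And>u. X \<le> u \<Longrightarrow> 1 \<le> ?D u"
    unfolding filterlim_at_top eventually_at_top_linorder by meson
  show ?thesis
  proof (rule strip_residue[where c' = "- \<beta>" and d' = \<beta> and X = X and D = "\<lambda>u. 1 / ?D u ^ m"])
    show "(\<lambda>z. 1 / (h z - of_real (hr x)) ^ m) holomorphic_on {z. - \<beta> < Im z \<and> Im z < \<beta>} - {of_real x}"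
      using h_eq_real_iff by (intro holomorphic_intros h_holomorphic) (auto simp: strip_def)
    show "cmod (1 / (h (Complex u y) - of_real (hr x)) ^ m) \<le> 1 / ?D \<bar>u\<bar> ^ m"
      if "X \<le> \<bar>u\<bar>" "- \<gamma> \<le> y" "y \<le> \<gamma>" for u y
    proof -
      have "1 \<le> ?D \<bar>u\<bar>" using X that by blast
      moreover have "?D \<bar>u\<bar> \<le> cmod (h (Complex u y) - of_real (hr x))"
        using that by (intro norm_h_ge) auto
      ultimately show ?thesis
        by (simp only: norm_divide norm_power norm_one) (intro frac_le power_mono zero_less_power; linarith)
    qed
    show "((\<lambda>u. 1 / ?D u ^ m) \<longlongrightarrow> 0) at_top"
      using m by (intro tendsto_divide_0[OF tendsto_const] filterlim_at_top_imp_at_infinity filterlim_pow_at_top D)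
  qed (use \<gamma>_pos \<gamma>_less m in \<open>auto intro!: integrable_inverse_h_power\<close>)
qed

text \<open>The point reflection z to - z exchanges the two lines, and h is odd; the overall sign
  comes from the odd exponent. It expresses the upper line in the residue formula through the lower
  one.\<close>

lemma integral_reflect_inverse_h:
  assumes "odd m"
  shows "(\<integral>u. 1 / (h (Complex u (- \<gamma>)) + of_real r) ^ m \<partial>lborel) =
      - (\<integral>u. 1 / (h (Complex u \<gamma>) - of_real r) ^ m \<partial>lborel)"
proof -
  have minus: "1 / (h (Complex (- u) (- \<gamma>)) + of_real r) ^ m = - (1 / (h (Complex u \<gamma>) - of_real r) ^ m)" for u
  proof -
    have "Complex (- u) (- \<gamma>) = - Complex u \<gamma>" by (simp add: complex_eq_iff)
    then have "h (Complex (- u) (- \<gamma>)) + of_real r = - (h (Complex u \<gamma>) - of_real r)"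
      by (simp add: h_minus)
    then show ?thesis by (simp only: power_minus_odd[OF assms] minus_divide_right)
  qed
  have "(\<integral>u. 1 / (h (Complex u (- \<gamma>)) + of_real r) ^ m \<partial>lborel) =
      (\<integral>u. 1 / (h (Complex (- u) (- \<gamma>)) + of_real r) ^ m \<partial>lborel)"
    by (subst lborel_integral_real_affine[where c = "-1" and t = 0]) simp_all
  then show ?thesis by (simp only: minus Bochner_Integration.integral_minus)
qed

text \<open>By reflection, minus the upper-line integral with pole x is the lower-line integral with
  pole - x. The residue formula thus becomes a sum over one line, and the simple pole contributes 1
  / h' x.\<close>

lemma integral_inverse_h_pair:
  "(\<integral>u. 1 / (h (Complex u (- \<gamma>)) - of_real (hr x)) \<partial>lborel) +
    (\<integral>u. 1 / (h (Complex u (- \<gamma>)) + of_real (hr x)) \<partial>lborel) = 2 * pi * \<i> / (s * cosh x - 1)"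
proof -
  have "residue (\<lambda>z. 1 / (h z - of_real (hr x))) (of_real x) = 1 / (of_real s * cosh (of_real x) - 1)"
  proof (rule residue_simple_pole_deriv[where s = UNIV])
    show "((\<lambda>z. h z - of_real (hr x)) has_field_derivative of_real s * cosh (of_real x) - 1) (at (of_real x))"
      using h_deriv by (auto intro!: derivative_eq_intros)
    show "of_real s * cosh (of_real x) - 1 \<noteq> (0 :: complex)"
      using hr_deriv_pos[of x] cosh_Complex[of x 0] by (simp add: complex_eq_iff flip: complex_of_real_def)
  qed (auto simp: h_of_real intro!: holomorphic_intros h_holomorphic)
  also note cosh_of_real_complex
  finally show ?thesis
    using strip_integral_inverse_h[of 1 x] integral_reflect_inverse_h[of 1 "hr x"] by simp
qed

text \<open>Near 0, 1 / h^(2n+1) is Q z / z^(2n+1) with Q = (z / h z)^(2n+1), so its residue is a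
  Taylor coefficient of Q; on the real axis Q is the power of \<open>sinh_quotient\<close> in the
  definition of the coefficients.\<close>

lemma integral_inverse_h_odd_power:
  "fact (2 * n) * (\<integral>u. 1 / h (Complex u (- \<gamma>)) ^ (2 * n + 1) \<partial>lborel) =
    pi * \<i> * of_real ((deriv ^^ (2 * n)) (\<lambda>t. sinh_quotient s t ^ (2 * n + 1)) 0)"
proof -
  \<comment> \<open>h z / z with its singularity at 0 removed; the value h' 0 = s - 1 there matches
    the value 1 / (s - 1) of \<open>sinh_quotient\<close>.\<close>
  define K where "K = (\<lambda>z. if z = 0 then deriv h 0 else (h z - h 0) / (z - 0))"
  define Q where "Q = (\<lambda>z. (1 / K z) ^ (2 * n + 1))"
  have strip: "open strip" "0 \<in> strip" "\<And>x. of_real x \<in> strip"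
    using \<gamma>_pos \<gamma>_less open_Int[OF open_halfspace_Im_gt[of "- \<beta>"] open_halfspace_Im_lt[of \<beta>]]
    by (auto simp: strip_def Int_def)
  have d0: "deriv h 0 = of_real (s - 1)"
    using DERIV_imp_deriv[OF h_deriv[of 0]] by simp
  have "K holomorphic_on strip"
    unfolding K_def using h_holomorphic strip(1) by (rule pole_lemma_open)
  moreover have "K z \<noteq> 0" if "z \<in> strip" for z
    using h_eq_real_iff[OF that, of 0] s_gt_1 by (auto simp: K_def d0 h_0 hr_def)
  ultimately have Q: "Q holomorphic_on strip"
    unfolding Q_def by (intro holomorphic_intros) auto
  have "residue (\<lambda>z. 1 / h z ^ (2 * n + 1)) 0 = residue (\<lambda>z. Q z / z ^ Suc (2 * n)) 0"
    by (rule residue_cong)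
       (auto simp: eventually_at_filter K_def Q_def h_0 power_divide intro!: always_eventually)
  also have "\<dots> = (deriv ^^ (2 * n)) Q 0 / fact (2 * n)"
    by (rule residue_holomorphic_over_power'[OF strip(1,2) Q])
  also have "(deriv ^^ (2 * n)) Q 0 = of_real ((deriv ^^ (2 * n)) (\<lambda>t. sinh_quotient s t ^ (2 * n + 1)) 0)"
  proof -
    have "Q (of_real t) = of_real (sinh_quotient s t ^ (2 * n + 1))" for t
      by (simp add: Q_def K_def d0 h_0 sinh_quotient_def h_of_real hr_def del: power_Suc)
    from higher_deriv_of_real[OF Q strip(1,3) this, of "2 * n" 0] show ?thesis by simp
  qed
  finally have res: "fact (2 * n) * residue (\<lambda>z. 1 / h z ^ (2 * n + 1)) 0 =
      of_real ((deriv ^^ (2 * n)) (\<lambda>t. sinh_quotient s t ^ (2 * n + 1)) 0)"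
    by simp
  define I where "I = (\<lambda>y. \<integral>u. 1 / h (Complex u y) ^ (2 * n + 1) \<partial>lborel)"
  define R where "R = residue (\<lambda>z. 1 / h z ^ (2 * n + 1)) 0"
  have hr_0: "hr 0 = 0" by (simp add: hr_def)
  have "0 < 2 * n + 1" "odd (2 * n + 1)" by simp_all
  from strip_integral_inverse_h[OF this(1), of 0] integral_reflect_inverse_h[OF this(2), of 0]
  have "I (- \<gamma>) - I \<gamma> = 2 * pi * \<i> * R" "I (- \<gamma>) = - I \<gamma>"
    unfolding hr_0 of_real_0 diff_0_right add_0_right I_def R_def .
  \<comment> \<open>The two lines carry opposite integrals, so each accounts for half of the
    residue: hence pi \<i> instead of 2 pi \<i>.\<close>
  then have "2 * I (- \<gamma>) = 2 * (pi * \<i> * R)" by simp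
  then have "I (- \<gamma>) = pi * \<i> * R" by (simp only: mult_cancel_left) simp
  then show ?thesis unfolding res[symmetric] I_def R_def by (simp only: mult_ac)
qed

section \<open>The weight, its moments and its cosine transform\<close>

definition \<phi> :: "real \<Rightarrow> complex" where "\<phi> u = \<i> * h (Complex u (- \<gamma>))"
text \<open>For t > 0 this is (2/pi) exp (pi t / 2) times the modified Bessel function K of order
  \<i> t at t s.\<close>

definition W :: "real \<Rightarrow> complex" where
  "W t = (\<integral>u. exp (- (\<phi> u * of_real t)) \<partial>lborel) / of_real pi"

lemma borel_measurable_\<phi> [measurable]: "\<phi> \<in> borel_measurable borel"
  using borel_measurable_h_line[of "- \<gamma>"] unfolding \<phi>_def [abs_def] by measurable

lemma Re_\<phi>_ge: "\<delta> * cosh u \<le> Re (\<phi> u)"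
  using Im_h_ge(2)[of u] by (simp add: \<phi>_def)

lemma \<delta>_cosh_pos: "0 < \<delta> * cosh u"
  using \<delta>_pos by simp

lemma Re_\<phi>_pos: "0 < Re (\<phi> u)"
  using Re_\<phi>_ge[of u] \<delta>_cosh_pos[of u] by linarith

lemma laplace_\<phi>:
  "(LINT t:{0<..}|lborel. of_real t ^ n * exp (- (\<phi> u * of_real t))) =
    fact n / \<phi> u ^ Suc n"
  by (rule laplace_power[OF Re_\<phi>_pos])

lemma norm_exp_\<phi>_le: "0 \<le> t \<Longrightarrow> cmod (exp (- (\<phi> u * of_real t))) \<le> exp (- (\<delta> * cosh u * t))"
  using Re_\<phi>_ge[of u] by (simp add: mult_right_mono)

text \<open>Integrating C t^m exp (- \<delta> t cosh u) over t first leaves a multiple of (cosh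
  u)^(-m-1), which 1 / cosh u dominates. Absolute integrability thus reaches down to t = 0, where a
  single exponential in t gives no uniform decay in u. Polynomial bounds on \<open>q\<close> cover
  moments, cosines and remainder kernels alike.\<close>

lemma integrable_weight_kernel:
  fixes q :: "real \<Rightarrow> complex"
  assumes q [measurable]: "q \<in> borel_measurable borel"
    and bound: "\<And>t. 0 < t \<Longrightarrow> cmod (q t) \<le> C * t ^ m"
  shows "integrable (lborel \<Otimes>\<^sub>M lborel)
    (\<lambda>(u, t). indicator {0<..} t *\<^sub>R (q t * exp (- (\<phi> u * of_real t))))"
proof (rule lborel_pair.Fubini_integrable)
  let ?f = "\<lambda>(u, t). indicator {0<..} t *\<^sub>R (q t * exp (- (\<phi> u * of_real t)))"
  have "0 \<le> cmod (q 1)" by simp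
  also have "\<dots> \<le> C" using bound[of 1] by simp
  finally have C: "0 \<le> C" .
  show meas [measurable]: "?f \<in> borel_measurable (lborel \<Otimes>\<^sub>M lborel)"
    by measurable
  have norm_le: "norm (?f (u, t)) \<le> indicator {0<..} t *\<^sub>R (C * (t ^ m * exp (- (\<delta> * cosh u * t))))" for u t
  proof (cases "0 < t")
    case True
    then have "cmod (q t) * cmod (exp (- (\<phi> u * of_real t))) \<le> C * t ^ m * exp (- (\<delta> * cosh u * t))"
      using C by (intro mult_mono bound norm_exp_\<phi>_le mult_nonneg_nonneg) auto
    then show ?thesis using True by (simp only: case_prod_conv norm_scaleR norm_mult) (simp add: mult.assoc)
  qed simp
  have dom: "integrable lborel (\<lambda>t. indicator {0<..} t *\<^sub>R (C * (t ^ m * exp (- (\<delta> * cosh u * t)))))" for u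
    using set_integrable_mult_right[OF set_integrable_power_exp_decay[OF \<delta>_cosh_pos[of u], of m], of C]
    unfolding set_integrable_def .
  have int: "integrable lborel (\<lambda>t. ?f (u, t))" for u
    by (rule Bochner_Integration.integrable_bound[OF dom[of u]])
       (use norm_le in \<open>auto intro!: AE_I2 order_trans[OF _ abs_ge_self]\<close>)
  show "AE u in lborel. integrable lborel (\<lambda>t. ?f (u, t))" using int by blast
  show "integrable lborel (\<lambda>u. \<integral>t. norm (?f (u, t)) \<partial>lborel)"
  proof (rule Bochner_Integration.integrable_bound)
    show "integrable lborel (\<lambda>u. C * fact m / \<delta> ^ Suc m * (1 / cosh u))"
      by (intro integrable_mult_right integrable_inverse_cosh)
    have le: "(\<integral>t. norm (?f (u, t)) \<partial>lborel) \<le> C * fact m / \<delta> ^ Suc m * (1 / cosh u)" for u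
    proof -
      have "(\<integral>t. norm (?f (u, t)) \<partial>lborel) \<le>
          (\<integral>t. indicator {0<..} t *\<^sub>R (C * (t ^ m * exp (- (\<delta> * cosh u * t)))) \<partial>lborel)"
        using norm_le int dom by (intro integral_mono integrable_norm) auto
      also have "\<dots> = (LINT t:{0<..}|lborel. C * (t ^ m * exp (- (\<delta> * cosh u * t))))"
        by (simp only: set_lebesgue_integral_def)
      also have "\<dots> = C * (fact m / (\<delta> * cosh u) ^ Suc m)"
        by (simp only: set_integral_mult_right laplace_real[OF \<delta>_cosh_pos])
      also have "\<dots> \<le> C * (fact m / (\<delta> ^ Suc m * cosh u))"
      proof (intro mult_left_mono frac_le C order_refl)
        show "\<delta> ^ Suc m * cosh u \<le> (\<delta> * cosh u) ^ Suc m"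
          unfolding power_mult_distrib
          using \<delta>_pos cosh_real_ge_1[of u] self_le_power[of "cosh u" "Suc m"]
          by (intro mult_left_mono) auto
        show "0 < \<delta> ^ Suc m * cosh u" using \<delta>_pos by simp
      qed simp
      finally show ?thesis by simp
    qed
    have nonneg: "0 \<le> (\<integral>t. norm (?f (u, t)) \<partial>lborel)" for u
      by (rule Bochner_Integration.integral_nonneg) simp
    show "AE u in lborel. norm (\<integral>t. norm (?f (u, t)) \<partial>lborel) \<le> norm (C * fact m / \<delta> ^ Suc m * (1 / cosh u))"
      by (intro AE_I2) (simp only: real_norm_def abs_of_nonneg[OF nonneg] order_trans[OF le abs_ge_self])
  qed measurable
qed

text \<open>Fubini: integrating against W means taking the Laplace transform of \<open>q\<close> at
  \<phi> u and then integrating over the line.\<close>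

lemma set_integral_weight:
  fixes q :: "real \<Rightarrow> complex"
  assumes q: "q \<in> borel_measurable borel" and bound: "\<And>t. 0 < t \<Longrightarrow> cmod (q t) \<le> C * t ^ m"
  shows "set_integrable lborel {0<..} (\<lambda>t. q t * W t)"
    and "(LINT t:{0<..}|lborel. q t * W t) =
      (\<integral>u. (LINT t:{0<..}|lborel. q t * exp (- (\<phi> u * of_real t))) \<partial>lborel) / of_real pi"
proof -
  let ?f = "\<lambda>u t. indicator {0<..} t *\<^sub>R (q t * exp (- (\<phi> u * of_real t)))"
  have int: "integrable (lborel \<Otimes>\<^sub>M lborel) (case_prod ?f)"
    using integrable_weight_kernel[OF q bound] by simp
  have eq: "(\<integral>u. ?f u t \<partial>lborel) = of_real pi * (indicator {0<..} t *\<^sub>R (q t * W t))" for t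
    by (simp add: W_def)
  have "integrable lborel (\<lambda>t. of_real pi * (indicator {0<..} t *\<^sub>R (q t * W t)))"
    using lborel_pair.integrable_snd[OF int] unfolding eq .
  from integrable_mult_right[OF this, of "1 / of_real pi"]
  show "set_integrable lborel {0<..} (\<lambda>t. q t * W t)"
    by (simp add: set_integrable_def)
  have "of_real pi * (LINT t:{0<..}|lborel. q t * W t) = (\<integral>t. \<integral>u. ?f u t \<partial>lborel \<partial>lborel)"
    unfolding eq set_lebesgue_integral_def by (rule integral_mult_right_zero[symmetric])
  also have "\<dots> = (\<integral>u. \<integral>t. ?f u t \<partial>lborel \<partial>lborel)"
    by (rule lborel_pair.Fubini_integral[OF int])
  finally show "(LINT t:{0<..}|lborel. q t * W t) =
      (\<integral>u. (LINT t:{0<..}|lborel. q t * exp (- (\<phi> u * of_real t))) \<partial>lborel) / of_real pi"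
    unfolding set_lebesgue_integral_def by (simp add: field_simps)
qed

text \<open>The Laplace transform of t^(2n) at \<phi> u = \<i> h is (2n)! / (\<i> h)^(2n+1), an odd
  power to which the residue at 0 applies; \<i>^(2n+1) = (-1)^n \<i> accounts for the sign.\<close>

lemma weight_moment:
  "(LINT t:{0<..}|lborel. of_real t ^ (2 * n) * W t) =
    of_real ((-1) ^ n * (deriv ^^ (2 * n)) (\<lambda>t. sinh_quotient s t ^ (2 * n + 1)) 0)"
proof -
  define E where "E = complex_of_real ((deriv ^^ (2 * n)) (\<lambda>t. sinh_quotient s t ^ (2 * n + 1)) 0)"
  have i: "\<i> ^ (2 * n + 1) = (-1) ^ n * \<i>" by (simp add: power_mult)
  have pt: "fact (2 * n) / \<phi> u ^ Suc (2 * n) = - \<i> * (-1) ^ n * fact (2 * n) * (1 / h (Complex u (- \<gamma>)) ^ (2 * n + 1))" for u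
  proof -
    have "\<phi> u ^ Suc (2 * n) = ((-1) ^ n * \<i>) * h (Complex u (- \<gamma>)) ^ (2 * n + 1)"
      unfolding \<phi>_def Suc_eq_plus1 power_mult_distrib i ..
    moreover have "a / ((-1) ^ n * \<i> * b) = - \<i> * (-1) ^ n * a * (1 / b)" for a b :: complex
    proof -
      have "a / ((-1) ^ n * \<i> * b) = a / b / \<i> / (-1) ^ n"
        by (simp only: divide_divide_eq_left mult_ac)
      then show ?thesis by (cases "even n") simp_all
    qed
    ultimately show ?thesis by (simp only:)
  qed
  have "(LINT t:{0<..}|lborel. of_real t ^ (2 * n) * W t) =
      (\<integral>u. - \<i> * (-1) ^ n * fact (2 * n) * (1 / h (Complex u (- \<gamma>)) ^ (2 * n + 1)) \<partial>lborel) / of_real pi"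
    by (subst set_integral_weight(2)[where C = 1 and m = "2 * n"])
       (auto simp only: laplace_\<phi> pt norm_power norm_of_real, auto)
  also have "\<dots> = - \<i> * (-1) ^ n * (fact (2 * n) * (\<integral>u. 1 / h (Complex u (- \<gamma>)) ^ (2 * n + 1) \<partial>lborel)) / of_real pi"
    by (simp only: integral_mult_right_zero mult.assoc)
  also have "\<dots> = - \<i> * (-1) ^ n * (pi * \<i> * E) / of_real pi"
    unfolding integral_inverse_h_odd_power E_def ..
  also have "\<dots> = (-1) ^ n * E" by (cases "even n") simp_all
  finally show ?thesis by (simp add: E_def)
qed

text \<open>The Laplace transform of the cosine has the simple fractions 1 / (\<phi> \<mp> \<i> hr
  x) = 1 / (\<i> (h \<mp> hr x)), precisely the pair whose sum is known from the residue at
  x.\<close>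

lemma weight_cos:
  "(LINT t:{0<..}|lborel. cos (of_real (hr x * t)) * W t) = 1 / of_real (s * cosh x - 1)"
proof -
  let ?g = "\<lambda>u. 1 / (h (Complex u (- \<gamma>)) - of_real (hr x))" and ?g' = "\<lambda>u. 1 / (h (Complex u (- \<gamma>)) + of_real (hr x))"
  have pt: "(1 / (\<phi> u - \<i> * of_real (hr x)) + 1 / (\<phi> u + \<i> * of_real (hr x))) / 2 = (?g u + ?g' u) / (2 * \<i>)" for u
    unfolding \<phi>_def right_diff_distrib[symmetric] distrib_left[symmetric]
    by (simp only: add_divide_distrib divide_divide_eq_left mult_ac)
  have cont: "(\<lambda>t. cos (complex_of_real (hr x * t))) \<in> borel_measurable borel"
    by (intro borel_measurable_continuous_onI continuous_intros)
  have bound: "cmod (cos (complex_of_real (hr x * t))) \<le> 1 * t ^ 0" for t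
    unfolding cos_of_real norm_of_real using abs_cos_le_one by simp
  have int: "integrable lborel ?g" "integrable lborel ?g'"
    using integrable_inverse_h_power[of "- \<gamma>" 1 "hr x"] integrable_inverse_h_power[of "- \<gamma>" 1 "- hr x"] \<gamma>_pos
    by simp_all
  have "(LINT t:{0<..}|lborel. cos (of_real (hr x * t)) * W t) = (\<integral>u. (?g u + ?g' u) / (2 * \<i>) \<partial>lborel) / of_real pi"
    by (simp only: set_integral_weight(2)[OF cont bound] laplace_cos[OF Re_\<phi>_pos] pt)
  also have "\<dots> = ((\<integral>u. ?g u \<partial>lborel) + (\<integral>u. ?g' u \<partial>lborel)) / (2 * \<i>) / of_real pi"
    by (simp only: integral_divide_zero Bochner_Integration.integral_add[OF int])
  also have "\<dots> = 1 / of_real (s * cosh x - 1)"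
  proof -
    have "of_real (2 * pi) * \<i> / d / (2 * \<i>) / of_real pi = 1 / d" for d :: complex
      by (cases "d = 0") (simp_all add: field_simps)
    then show ?thesis unfolding integral_inverse_h_pair .
  qed
  finally show ?thesis .
qed

text \<open>Moving the line of integration up by \<open>\<pi>/2 - \<gamma>\<close> gains the factor \<open>exp (- \<pi> t / 2)\<close>, which
  cancels the exponentially large factor in \<open>hankel_H1_imaginary\<close>.\<close>
lemma shift_bessel_contour:
  assumes t: "0 < t"
  shows "(\<integral>u. exp (\<i> * of_real t * of_real u - of_real (t * s * cosh u)) \<partial>lborel) =
    exp (- (of_real pi * of_real t / 2)) * (of_real pi * W t)"
proof -
  \<comment> \<open>For w = u - \<i> \<gamma> the point u + \<i> \<theta> is w + \<i> pi / 2, where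
    cosh becomes \<i> sinh w. This turns \<i> z - s cosh z into - pi / 2 - \<i> h w.\<close>
  define \<theta> where "\<theta> = pi / 2 - \<gamma>"
  have \<theta>: "0 < \<theta>" "\<theta> < pi / 2" using \<gamma>_pos \<gamma>_less \<beta>_less by (simp_all add: \<theta>_def)
  define G where "G = (\<lambda>z. exp (of_real t * (\<i> * z - of_real s * cosh z)))"
  have G_0: "G (Complex u 0) = exp (\<i> * of_real t * of_real u - of_real (t * s * cosh u))" for u
    by (simp add: G_def cosh_of_real_complex algebra_simps flip: complex_of_real_def)
  have G_\<theta>: "G (Complex u \<theta>) = exp (- (of_real pi * of_real t / 2)) * exp (- (\<phi> u * of_real t))" for u
  proof -
    have trig: "cos \<theta> = sin \<gamma>" "sin \<theta> = cos \<gamma>"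
      by (simp_all add: \<theta>_def cos_diff sin_diff)
    have "\<i> * Complex u \<theta> - of_real s * cosh (Complex u \<theta>) = - (of_real pi / 2) - \<phi> u"
      by (simp add: complex_eq_iff cosh_Complex trig \<phi>_def Re_h Im_h) (simp add: \<theta>_def)
    then have "G (Complex u \<theta>) = exp (of_real t * (- (of_real pi / 2) - \<phi> u))"
      by (simp only: G_def)
    also have "of_real t * (- (of_real pi / 2) - \<phi> u) = - (of_real pi * of_real t / 2) + - (\<phi> u * of_real t)"
      by (simp add: algebra_simps)
    finally show ?thesis by (simp only: exp_add)
  qed
  have norm_G: "cmod (G (Complex x y)) = exp (t * (- y - s * cosh x * cos y))" for x y
    by (simp add: G_def cosh_Complex)
  have hol: "G holomorphic_on UNIV"
    unfolding G_def cosh_field_def by (intro holomorphic_intros) auto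
  \<comment> \<open>G is entire: the outer bounds -1 and \<theta> + 1 are arbitrary, and \<i>
    \<theta> / 2 is just some regular point between the lines, with residue 0.\<close>
  have "(\<integral>u. G (Complex u 0) \<partial>lborel) - (\<integral>u. G (Complex u \<theta>) \<partial>lborel) = 2 * pi * \<i> * residue G (Complex 0 (\<theta> / 2))"
  proof (rule strip_residue[where c' = "-1" and d' = "\<theta> + 1" and X = 0 and D = "\<lambda>x. exp (- (t * s * sin \<gamma> * cosh x))"])
    show "cmod (G (Complex x y)) \<le> exp (- (t * s * sin \<gamma> * cosh \<bar>x\<bar>))" if "0 \<le> y" "y \<le> \<theta>" for x y
    proof -
      \<comment> \<open>Up to height \<theta> < pi / 2 the cosine stays at least cos \<theta> = sin
        \<gamma> > 0, so the double exponential decay survives on the vertical sides.\<close>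
      have "cos \<theta> \<le> cos y" using that \<theta> by (intro cos_monotone_0_pi_le) auto
      then have "sin \<gamma> \<le> cos y" by (simp add: \<theta>_def cos_diff)
      then have "s * cosh x * sin \<gamma> \<le> s * cosh x * cos y"
        using s_gt_1 by (intro mult_left_mono) auto
      then have "- y - s * cosh x * cos y \<le> - (s * cosh x * sin \<gamma>)" using that by linarith
      then have "t * (- y - s * cosh x * cos y) \<le> t * - (s * cosh x * sin \<gamma>)"
        using t by (intro mult_left_mono) auto
      then show ?thesis unfolding norm_G by (simp add: mult_ac)
    qed
    have "0 < t * s * sin \<gamma>"
      using t s_gt_1 \<gamma>_pos \<gamma>_less \<beta>_less by (intro mult_pos_pos sin_gt_zero) auto
    moreover have "((\<lambda>x. exp (- (k * cosh x))) \<longlongrightarrow> 0) at_top" if "0 < k" for k :: real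
      using that unfolding cosh_field_def by real_asymp
    ultimately show "((\<lambda>x. exp (- (t * s * sin \<gamma> * cosh x))) \<longlongrightarrow> 0) at_top"
      by blast
    show "integrable lborel (\<lambda>x. G (Complex x 0))"
      unfolding G_0 by (rule bessel_K_integral(1)) (use t s_gt_1 in auto)
    show "integrable lborel (\<lambda>x. G (Complex x \<theta>))"
      unfolding G_\<theta>
    proof (rule integrable_mult_right, rule Bochner_Integration.integrable_bound)
      show "integrable lborel (\<lambda>u. 1 / (\<delta> * t) * (1 / cosh u))"
        by (intro integrable_mult_right integrable_inverse_cosh)
      have "cmod (exp (- (\<phi> u * of_real t))) \<le> 1 / (\<delta> * t) * (1 / cosh u)" for u
      proof -
        define p where "p = \<delta> * cosh u * t"
        have p: "0 < p" using t \<delta>_pos by (simp add: p_def)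
        have "cmod (exp (- (\<phi> u * of_real t))) \<le> exp (- p)"
          using norm_exp_\<phi>_le[of t u] t by (simp add: p_def)
        also have "\<dots> = 1 / exp p" by (simp add: exp_minus inverse_eq_divide)
        also have "\<dots> \<le> 1 / p"
          using exp_ge_add_one_self[of p] p by (intro frac_le; linarith)
        finally show ?thesis by (simp add: p_def mult_ac)
      qed
      then show "AE u in lborel. norm (exp (- (\<phi> u * of_real t))) \<le> norm (1 / (\<delta> * t) * (1 / cosh u))"
  by (intro AE_I2) (simp only: real_norm_def order_trans[OF _ abs_ge_self])
    qed measurable
  qed (use \<theta> hol in \<open>auto intro: holomorphic_on_subset\<close>)
  also have "residue G (Complex 0 (\<theta> / 2)) = 0"
    by (rule residue_holo[OF open_UNIV UNIV_I hol])
  finally have "(\<integral>u. G (Complex u 0) \<partial>lborel) = (\<integral>u. G (Complex u \<theta>) \<partial>lborel)" by simp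
  then show ?thesis
    unfolding G_0 G_\<theta> W_def by (simp only: integral_mult_right_zero) simp
qed

lemma hankel_weight_eq:
  assumes t: "0 < t"
  shows "hankel_weight \<beta> t = W t"
proof -
  have "hankel_weight \<beta> t = \<i> * hankel_H1 (\<i> * of_real t) (\<i> * of_real (t * s))"
    by (simp add: hankel_weight_def s_def mult.assoc)
  also have "\<dots> = exp (- (\<i> * of_real pi * (\<i> * of_real t) / 2)) / of_real pi *
      (\<integral>u. exp (\<i> * of_real t * of_real u - of_real (t * s * cosh u)) \<partial>lborel)"
    using t s_gt_1 by (intro hankel_H1_imaginary) auto
  also have "- (\<i> * of_real pi * (\<i> * of_real t) / 2) = of_real pi * of_real t / 2"
    by (simp add: complex_eq_iff)
  also have "exp (of_real pi * of_real t / 2) / of_real pi *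
      (\<integral>u. exp (\<i> * of_real t * of_real u - of_real (t * s * cosh u)) \<partial>lborel) =
      (exp (of_real pi * of_real t / 2) * exp (- (of_real pi * of_real t / 2))) * W t"
    unfolding shift_bessel_contour[OF t] by simp
  also have "\<dots> = W t" by (simp only: mult_exp_exp) simp
  finally show ?thesis .
qed

section \<open>Laplace integrals in the variable hr x\<close>

lemma hr_at_top: "filterlim hr at_top at_top"
  using s_gt_1 unfolding hr_def [abs_def] sinh_field_def by real_asymp

lemma hr_continuous: "continuous_on A hr"
  unfolding hr_def [abs_def] by (intro continuous_intros)

text \<open>The factor s cosh x - 1 is hr' x, so an antiderivative is explicit; as the integrand is
  non-negative, finite limits of the antiderivative already give integrability.\<close>

lemma set_integrable_exp_hr:
  assumes a: "0 < a"
  shows "set_integrable lborel {0<..} (\<lambda>x. exp (- (a * hr x)) * (s * cosh x - 1))"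
proof -
  let ?F = "\<lambda>x. - exp (- (a * hr x)) / a"
  have lim: "(?F \<longlongrightarrow> - 0 / a) at_top"
  proof (intro tendsto_divide tendsto_minus tendsto_const)
    show "((\<lambda>x. exp (- (a * hr x))) \<longlongrightarrow> 0) at_top"
      by (intro filterlim_compose[OF exp_at_bot] filterlim_uminus_at_top[THEN iffD1]
          filterlim_tendsto_pos_mult_at_top[OF tendsto_const a] hr_at_top)
  qed (use a in simp)
  have cont: "continuous_on UNIV ?F"
    using a by (intro continuous_intros hr_continuous) auto
  have "set_integrable lborel (einterval 0 \<infinity>) (\<lambda>x. exp (- (a * hr x)) * (s * cosh x - 1))"
  proof (rule interval_integral_FTC_nonneg(1)[where F = ?F])
    show "DERIV ?F x :> exp (- (a * hr x)) * (s * cosh x - 1)" for x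
      using a by (auto intro!: derivative_eq_intros hr_deriv simp: field_simps)
    show "isCont (\<lambda>x. exp (- (a * hr x)) * (s * cosh x - 1)) x" for x
      using hr_continuous[of UNIV] by (auto intro!: continuous_intros simp: continuous_on_eq_continuous_at)
    show "AE x in lborel. 0 < ereal x \<longrightarrow> ereal x < \<infinity> \<longrightarrow> 0 \<le> exp (- (a * hr x)) * (s * cosh x - 1)"
      using hr_deriv_pos by (intro AE_I2) (simp add: less_imp_le)
    show "((?F \<circ> real_of_ereal) \<longlongrightarrow> ?F 0) (at_right 0)"
      using cont unfolding zero_ereal_def ereal_tendsto_simps
      by (simp add: continuous_on_eq_continuous_at isCont_def filterlim_at_split)
    show "((?F \<circ> real_of_ereal) \<longlongrightarrow> - 0 / a) (at_left \<infinity>)"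
      using lim unfolding ereal_tendsto_simps .
  qed simp
  moreover have "einterval 0 \<infinity> = {0<..}" by (auto simp: einterval_def)
  ultimately show ?thesis by simp
qed

lemma exp_hr_complex:
  assumes w: "0 < Re w"
  shows "set_integrable lborel {0<..} (\<lambda>x. exp (- (w * of_real (hr x))) * of_real (s * cosh x - 1))"
    and "(LINT x:{0<..}|lborel. exp (- (w * of_real (hr x))) * of_real (s * cosh x - 1)) = 1 / w"
proof -
  let ?f = "\<lambda>x. exp (- (w * of_real (hr x))) * of_real (s * cosh x - 1)"
  let ?F = "\<lambda>x. - exp (- (w * of_real (hr x))) / w"
  have cont: "continuous_on UNIV ?f"
    by (intro continuous_intros hr_continuous)
  have norm_f: "cmod (?f x) = exp (- (Re w * hr x)) * (s * cosh x - 1)" for x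
    using hr_deriv_pos[of x] by (simp only: norm_mult norm_of_real norm_exp_eq_Re) simp
  show int: "set_integrable lborel {0<..} ?f"
  proof (rule set_integrable_bound[OF set_integrable_exp_hr[OF w]])
    show "AE x in lborel. x \<in> {0<..} \<longrightarrow> norm (?f x) \<le> norm (exp (- (Re w * hr x)) * (s * cosh x - 1))"
      unfolding norm_f by (intro AE_I2 impI) (simp only: real_norm_def abs_ge_self)
    show "set_borel_measurable lborel {0<..} ?f"
      unfolding set_borel_measurable_def using borel_measurable_continuous_onI[OF cont] by simp
  qed
  have "(LINT x:{0<..}|lborel. ?f x) = 0 - ?F 0"
  proof (rule set_integral_FTC_Ioi[where F = ?F, OF _ cont int])
    show "(?F has_vector_derivative ?f x) (at x)" for x
    proof -
      have "((\<lambda>x. complex_of_real (hr x)) has_vector_derivative of_real (s * cosh x - 1)) (at x)"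
        using hr_deriv[of x] by (rule has_vector_derivative_of_real)
      moreover have "((\<lambda>z. - exp (- (w * z)) / w) has_field_derivative exp (- (w * z))) (at z)" for z
        using w by (auto intro!: derivative_eq_intros)
      ultimately have "((\<lambda>z. - exp (- (w * z)) / w) \<circ> (\<lambda>x. complex_of_real (hr x)) has_vector_derivative
          of_real (s * cosh x - 1) * exp (- (w * of_real (hr x)))) (at x)"
        by (intro field_vector_diff_chain_at)
      then show ?thesis by (simp only: o_def mult.commute)
    qed
    show "(?F \<longlongrightarrow> 0) at_top"
    proof (rule tendsto_norm_zero_cancel)
      have "((\<lambda>x. exp (- (Re w * hr x)) / cmod w) \<longlongrightarrow> 0 / cmod w) at_top"
        by (intro tendsto_divide tendsto_const filterlim_compose[OF exp_at_bot] filterlim_uminus_at_top[THEN iffD1]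
          filterlim_tendsto_pos_mult_at_top[OF tendsto_const w] hr_at_top) (use w in auto)
      then show "((\<lambda>x. norm (?F x)) \<longlongrightarrow> 0) at_top" by (simp add: norm_divide)
    qed
  qed
  then show "(LINT x:{0<..}|lborel. ?f x) = 1 / w" by (simp add: hr_def)
qed

section \<open>The expansion\<close>

lemma weight_integrable: "set_integrable lborel {0<..} W"
  using set_integral_weight(1)[of "\<lambda>_. 1" 1 0] by simp

text \<open>Both iterated integrals of \<open>exp (- \<nu> hr x) hr' x cos (t hr x) W t\<close> are explicit: integrating
  out \<open>t\<close> produces \<open>1 / hr' x\<close>, and integrating out \<open>x\<close> produces \<open>\<nu> / (\<nu>\<^sup>2 + t\<^sup>2)\<close>.\<close>
lemma laplace_hr_eq_weight_integral:
  assumes \<nu>: "0 < Re \<nu>"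
  shows "(LINT x:{0<..}|lborel. exp (- (\<nu> * of_real (hr x)))) =
    (LINT t:{0<..}|lborel. \<nu> / (\<nu>\<^sup>2 + of_real t ^ 2) * W t)"
proof -
  define g where "g = (\<lambda>x. exp (- (\<nu> * of_real (hr x))) * of_real (s * cosh x - 1))"
  define f where "f = (\<lambda>x. indicator {0<..} x *\<^sub>R g x)"
  define w where "w = (\<lambda>t. indicator {0<..} t *\<^sub>R W t)"
  define k where "k = (\<lambda>x t. cos (of_real (hr x * t)) * (f x * w t))"
  have f: "integrable lborel f" and w: "integrable lborel w"
    using exp_hr_complex(1)[OF \<nu>] weight_integrable by (simp_all add: f_def g_def w_def set_integrable_def)
  have fw: "integrable (lborel \<Otimes>\<^sub>M lborel) (\<lambda>(x, t). f x * w t)"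
    by (rule integrable_product_lborel[OF f w])
  have [measurable]: "hr \<in> borel_measurable borel"
    by (intro borel_measurable_continuous_onI hr_continuous)
  have [measurable]: "f \<in> borel_measurable borel" "w \<in> borel_measurable borel"
    using f w by (auto dest: borel_measurable_integrable)
  have cos_le: "cmod (cos (complex_of_real r)) \<le> 1" for r
    unfolding cos_of_real norm_of_real using abs_cos_le_one by simp
  \<comment> \<open>hr x * t is real, so the cosine is at most 1 in modulus and a product of
    integrable functions of one variable dominates.\<close>
  have "integrable (lborel \<Otimes>\<^sub>M lborel) (case_prod k)"
  proof (rule Bochner_Integration.integrable_bound[OF fw])
    show "case_prod k \<in> borel_measurable (lborel \<Otimes>\<^sub>M lborel)"
      unfolding k_def cos_of_real by measurable
    show "AE p in lborel \<Otimes>\<^sub>M lborel. norm (case_prod k p) \<le> norm (case p of (x, t) \<Rightarrow> f x * w t)"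
      using cos_le by (intro AE_I2) (auto simp: k_def norm_mult[of "cos _"] simp del: of_real_mult intro!: mult_left_le_one_le)
  qed
  from lborel_pair.Fubini_integral[OF this]
  have swap: "(\<integral>t. \<integral>x. k x t \<partial>lborel \<partial>lborel) = (\<integral>x. \<integral>t. k x t \<partial>lborel \<partial>lborel)" .
  have "(\<integral>t. k x t \<partial>lborel) = indicator {0<..} x *\<^sub>R exp (- (\<nu> * of_real (hr x)))" for x
  proof -
    have "(\<integral>t. k x t \<partial>lborel) = (\<integral>t. f x * (indicator {0<..} t *\<^sub>R (cos (of_real (hr x * t)) * W t)) \<partial>lborel)"
      unfolding k_def w_def by (simp add: mult_ac)
    also have "\<dots> = f x * (LINT t:{0<..}|lborel. cos (of_real (hr x * t)) * W t)"
      unfolding set_lebesgue_integral_def by (rule integral_mult_right_zero)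
    also have "\<dots> = f x * (1 / of_real (s * cosh x - 1))"
      unfolding weight_cos ..
    also have "\<dots> = indicator {0<..} x *\<^sub>R exp (- (\<nu> * of_real (hr x)))"
    proof -
      have nz: "complex_of_real (s * cosh x - 1) \<noteq> 0"
        using hr_deriv_pos[of x] of_real_eq_0_iff by (metis less_irrefl)
      have "g x * (1 / of_real (s * cosh x - 1)) = exp (- (\<nu> * of_real (hr x)))"
        unfolding g_def times_divide_eq_right mult_1_right by (rule nonzero_mult_div_cancel_right[OF nz])
      then show ?thesis unfolding f_def by (simp only: mult_scaleR_left)
    qed
    finally show ?thesis .
  qed
  then have "(\<integral>x. \<integral>t. k x t \<partial>lborel \<partial>lborel) = (LINT x:{0<..}|lborel. exp (- (\<nu> * of_real (hr x))))"
    by (simp only: set_lebesgue_integral_def)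
  moreover have "(\<integral>x. k x t \<partial>lborel) = indicator {0<..} t *\<^sub>R (\<nu> / (\<nu>\<^sup>2 + of_real t ^ 2) * W t)" for t
  proof -
    let ?e = "\<lambda>z x. exp (- (z * of_real (hr x))) * complex_of_real (s * cosh x - 1)"
    let ?a = "\<nu> - \<i> * of_real t" and ?b = "\<nu> + \<i> * of_real t"
    have ab: "0 < Re ?a" "0 < Re ?b" using \<nu> by simp_all
    have pt: "cos (of_real (hr x * t)) * g x = (?e ?a x + ?e ?b x) / 2" for x
    proof -
      have "cos (of_real (hr x * t)) * exp (- (\<nu> * of_real (hr x))) =
          (exp (- (?a * of_real (hr x))) + exp (- (?b * of_real (hr x)))) / 2"
        by (simp add: cos_exp_eq field_simps mult_exp_exp flip: of_real_mult)
      then show ?thesis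
        unfolding g_def mult.assoc[symmetric] by (simp only: distrib_right times_divide_eq_left)
    qed
    have "(\<integral>x. k x t \<partial>lborel) = (\<integral>x. w t * (indicator {0<..} x *\<^sub>R (cos (of_real (hr x * t)) * g x)) \<partial>lborel)"
      unfolding k_def f_def by (simp add: mult_ac)
    also have "\<dots> = w t * (LINT x:{0<..}|lborel. cos (of_real (hr x * t)) * g x)"
      unfolding set_lebesgue_integral_def by (rule integral_mult_right_zero)
    also have "(LINT x:{0<..}|lborel. cos (of_real (hr x * t)) * g x) = (1 / ?a + 1 / ?b) / 2"
      by (simp only: pt set_integral_divide_zero set_integral_add(2)[OF exp_hr_complex(1)[OF ab(1)] exp_hr_complex(1)[OF ab(2)]]
          exp_hr_complex(2)[OF ab(1)] exp_hr_complex(2)[OF ab(2)])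
    also have "(1 / ?a + 1 / ?b) / 2 = \<nu> / (\<nu>\<^sup>2 + of_real t ^ 2)"
    proof -
      have nz: "?a \<noteq> 0" "?b \<noteq> 0" using ab by (metis less_irrefl zero_complex.sel(1))+
      have "?a * ?b = \<nu>\<^sup>2 + of_real t ^ 2" by (simp add: algebra_simps power2_eq_square)
      then have "1 / ?a + 1 / ?b = 2 * \<nu> / (\<nu>\<^sup>2 + of_real t ^ 2)"
        using nz by (simp add: add_frac_eq)
      moreover have "2 * \<nu> / d / 2 = \<nu> / d" for d by simp
      ultimately show ?thesis by (simp only:)
    qed
    finally show ?thesis by (simp only: w_def mult_scaleR_left mult.commute)
  qed
  then have "(\<integral>t. \<integral>x. k x t \<partial>lborel \<partial>lborel) = (LINT t:{0<..}|lborel. \<nu> / (\<nu>\<^sup>2 + of_real t ^ 2) * W t)"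
    by (simp only: set_lebesgue_integral_def)
  ultimately show ?thesis using swap by simp
qed

section \<open>The finite geometric series and the remainder\<close>

text \<open>\<nu>^2 + t^2 = (\<nu> + \<i> t) (\<nu> - \<i> t), and both factors have real part Re
  \<nu> > 0; hence a bound independent of t.\<close>

lemma remainder_kernel_bound:
  assumes \<nu>: "0 < Re \<nu>"
  shows "1 + (of_real t / \<nu>)\<^sup>2 \<noteq> 0"
    and "cmod (1 / (1 + (of_real t / \<nu>)\<^sup>2)) \<le> (cmod \<nu> / Re \<nu>)\<^sup>2"
proof -
  have nz: "\<nu> \<noteq> 0" using \<nu> by auto
  have "Re \<nu> \<le> cmod (\<nu> + \<i> * of_real t)" "Re \<nu> \<le> cmod (\<nu> - \<i> * of_real t)"
    using complex_Re_le_cmod[of "\<nu> + \<i> * of_real t"] complex_Re_le_cmod[of "\<nu> - \<i> * of_real t"] by simp_all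
  then have "Re \<nu> * Re \<nu> \<le> cmod (\<nu> + \<i> * of_real t) * cmod (\<nu> - \<i> * of_real t)"
    using \<nu> by (intro mult_mono) auto
  moreover have "(\<nu> + \<i> * of_real t) * (\<nu> - \<i> * of_real t) = \<nu>\<^sup>2 + of_real t ^ 2"
    by (simp add: algebra_simps power2_eq_square)
  ultimately have le: "(Re \<nu>)\<^sup>2 \<le> cmod (\<nu>\<^sup>2 + of_real t ^ 2)"
    by (metis norm_mult power2_eq_square)
  have eq: "1 + (of_real t / \<nu>)\<^sup>2 = (\<nu>\<^sup>2 + of_real t ^ 2) / \<nu>\<^sup>2"
    using nz by (simp add: power_divide add_divide_distrib)
  have pos: "0 < (Re \<nu>)\<^sup>2" using \<nu> by simp
  then have "\<nu>\<^sup>2 + of_real t ^ 2 \<noteq> 0" using le by auto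
  then show "1 + (of_real t / \<nu>)\<^sup>2 \<noteq> 0" unfolding eq using nz by simp
  have "cmod (1 / (1 + (of_real t / \<nu>)\<^sup>2)) = (cmod \<nu>)\<^sup>2 / cmod (\<nu>\<^sup>2 + of_real t ^ 2)"
    unfolding eq by (simp add: norm_divide norm_power)
  also have "\<dots> \<le> (cmod \<nu>)\<^sup>2 / (Re \<nu>)\<^sup>2"
    using le pos by (intro frac_le) auto
  finally show "cmod (1 / (1 + (of_real t / \<nu>)\<^sup>2)) \<le> (cmod \<nu> / Re \<nu>)\<^sup>2"
    by (simp add: power_divide)
qed

definition remainder_integral :: "complex \<Rightarrow> nat \<Rightarrow> complex" where
  "remainder_integral \<nu> N = (LINT t:{0<..}|lborel. of_real t ^ (2 * N) / (1 + (of_real t / \<nu>)\<^sup>2) * W t)"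

lemma remainder_integrable:
  assumes \<nu>: "0 < Re \<nu>"
  shows "set_integrable lborel {0<..} (\<lambda>t. of_real t ^ (2 * N) / (1 + (of_real t / \<nu>)\<^sup>2) * W t)"
proof (rule set_integral_weight(1))
  show "(\<lambda>t. complex_of_real t ^ (2 * N) / (1 + (complex_of_real t / \<nu>)\<^sup>2)) \<in> borel_measurable borel"
    by measurable
  show "cmod (complex_of_real t ^ (2 * N) / (1 + (complex_of_real t / \<nu>)\<^sup>2)) \<le> (cmod \<nu> / Re \<nu>)\<^sup>2 * t ^ (2 * N)"
    if "0 < t" for t
  proof -
    have "cmod (complex_of_real t ^ (2 * N) / (1 + (complex_of_real t / \<nu>)\<^sup>2)) =
        cmod (1 / (1 + (complex_of_real t / \<nu>)\<^sup>2)) * t ^ (2 * N)"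
      using that by (simp add: norm_divide norm_power)
    also have "\<dots> \<le> (cmod \<nu> / Re \<nu>)\<^sup>2 * t ^ (2 * N)"
      by (intro mult_right_mono remainder_kernel_bound \<nu>) (use that in simp)
    finally show ?thesis .
  qed
qed

lemma moment_integrable: "set_integrable lborel {0<..} (\<lambda>t. of_real t ^ (2 * n) * W t)"
  by (rule set_integral_weight(1)[where C = 1 and m = "2 * n"]) (simp_all add: norm_power)

text \<open>One step 1 / (1 + q) = 1 - q / (1 + q) of the geometric series, with q = (t / \<nu>)^2;
  the split is allowed since both parts are integrable against W.\<close>

lemma remainder_integral_step:
  assumes \<nu>: "0 < Re \<nu>"
  shows "remainder_integral \<nu> N =
    (LINT t:{0<..}|lborel. of_real t ^ (2 * N) * W t) - remainder_integral \<nu> (Suc N) / \<nu>\<^sup>2"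
proof -
  have nz: "\<nu> \<noteq> 0" using \<nu> by auto
  have "of_real t ^ (2 * N) / (1 + (of_real t / \<nu>)\<^sup>2) * W t =
      of_real t ^ (2 * N) * W t - of_real t ^ (2 * Suc N) / (1 + (of_real t / \<nu>)\<^sup>2) * W t / \<nu>\<^sup>2" for t
  proof -
    define d where "d = 1 + (of_real t / \<nu>)\<^sup>2"
    have d: "d \<noteq> 0" unfolding d_def by (rule remainder_kernel_bound(1)[OF \<nu>])
    have "of_real t ^ (2 * Suc N) = of_real t ^ (2 * N) * ((d - 1) * \<nu>\<^sup>2)"
      using nz by (simp add: d_def power_divide power_add[symmetric])
    moreover have "X * ((d - 1) * \<nu>\<^sup>2) / d * Y / \<nu>\<^sup>2 = X * (d - 1) / d * Y" for X Y
      using nz d by (simp add: divide_simps)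
    ultimately have "of_real t ^ (2 * Suc N) / d * W t / \<nu>\<^sup>2 = of_real t ^ (2 * N) * (d - 1) / d * W t"
      by (simp only:)
    also have "\<dots> = of_real t ^ (2 * N) * W t - of_real t ^ (2 * N) / d * W t"
      using d by (simp add: right_diff_distrib diff_divide_distrib left_diff_distrib)
    finally show ?thesis unfolding d_def[symmetric] by simp
  qed
  then show ?thesis
    unfolding remainder_integral_def
    by (simp only: set_integral_diff(2)[OF moment_integrable set_integrable_divide[OF remainder_integrable[OF \<nu>]]]
        set_integral_divide_zero)
qed

lemma remainder_integral_expansion:
  assumes \<nu>: "0 < Re \<nu>"
  shows "remainder_integral \<nu> 0 / \<nu> =
    (\<Sum>n<N. (-1) ^ n * (LINT t:{0<..}|lborel. of_real t ^ (2 * n) * W t) / \<nu> ^ (2 * n + 1)) +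
      (-1) ^ N / \<nu> ^ (2 * N + 1) * remainder_integral \<nu> N"
proof (induction N)
  case (Suc N)
  have nz: "\<nu> \<noteq> 0" using \<nu> by auto
  have "(-1) ^ N / \<nu> ^ (2 * N + 1) * remainder_integral \<nu> N =
      (-1) ^ N * (LINT t:{0<..}|lborel. of_real t ^ (2 * N) * W t) / \<nu> ^ (2 * N + 1) +
      (-1) ^ Suc N / \<nu> ^ (2 * Suc N + 1) * remainder_integral \<nu> (Suc N)"
    unfolding remainder_integral_step[OF \<nu>, of N]
    using nz by (simp add: right_diff_distrib power2_eq_square)
  with Suc show ?case by simp
qed simp

lemma laplace_hr_expansion:
  assumes \<nu>: "0 < Re \<nu>"
  shows "(LINT x:{0<..}|lborel. exp (- (\<nu> * of_real (hr x)))) =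
    (\<Sum>n<N. (-1) ^ n * (LINT t:{0<..}|lborel. of_real t ^ (2 * n) * W t) / \<nu> ^ (2 * n + 1)) +
      (-1) ^ N / \<nu> ^ (2 * N + 1) * remainder_integral \<nu> N"
proof -
  have nz: "\<nu> \<noteq> 0" using \<nu> by auto
  have "\<nu> / (\<nu>\<^sup>2 + of_real t ^ 2) = 1 / (1 + (of_real t / \<nu>)\<^sup>2) / \<nu>" for t
    using nz by (simp add: power_divide divide_simps power2_eq_square)
  then have "(LINT x:{0<..}|lborel. exp (- (\<nu> * of_real (hr x)))) = remainder_integral \<nu> 0 / \<nu>"
    unfolding laplace_hr_eq_weight_integral[OF \<nu>] remainder_integral_def
    by (simp add: set_integral_divide_zero[symmetric])
  then show ?thesis using remainder_integral_expansion[OF \<nu>] by simp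
qed

text \<open>Since sinh x \<ge> x, the phase grows at least linearly: hr x \<ge> (s - 1) x, with s >
  1.\<close>

lemma set_integrable_exp_hr_complex:
  assumes \<nu>: "0 < Re \<nu>"
  shows "set_integrable lborel {0<..} (\<lambda>x. exp (- (\<nu> * of_real (hr x))))"
proof (rule set_integrable_bound)
  show "set_integrable lborel {0<..} (\<lambda>x. exp (- (Re \<nu> * (s - 1) * x)))"
    using \<nu> s_gt_1 by (intro set_integrable_exp_decay) auto
  have "(s - 1) * x \<le> hr x" if "0 < x" for x
  proof -
    have "x \<le> sinh x"
      using real_le_x_sinh[of x] that by (simp add: sinh_field_def exp_minus)
    then have "s * x \<le> s * sinh x" using s_gt_1 by (intro mult_left_mono) auto
    then show ?thesis by (simp add: hr_def algebra_simps)
  qed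
  then have "Re \<nu> * (s - 1) * x \<le> Re \<nu> * hr x" if "0 < x" for x
    using \<nu> that unfolding mult.assoc by (intro mult_left_mono) auto
  then show "AE x in lborel. x \<in> {0<..} \<longrightarrow> norm (exp (- (\<nu> * of_real (hr x)))) \<le> norm (exp (- (Re \<nu> * (s - 1) * x)))"
    by simp
  show "set_borel_measurable lborel {0<..} (\<lambda>x. exp (- (\<nu> * of_real (hr x))))"
    unfolding set_borel_measurable_def
    using borel_measurable_continuous_onI[of "\<lambda>x. exp (- (\<nu> * of_real (hr x)))"] hr_continuous
    by (simp add: continuous_intros)
qed

end

theorem theorem1p1:
  fixes \<beta> :: real and N :: nat
  assumes "0 < \<beta>" and "\<beta> < pi / 2"
  shows "(\<forall>n::nat.
            set_integrable lborel {0<..} (\<lambda>t. of_real t ^ (2 * n) * hankel_weight \<beta> t) \<and>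
            complex_of_real (anger_weber_coeff n (- sec \<beta>)) =
              (-1) ^ (n + 1) / fact (2 * n) *
              (LINT t:{0<..}|lborel. of_real t ^ (2 * n) * hankel_weight \<beta> t)) \<and>
         (\<forall>\<nu>::complex. \<nu> \<noteq> 0 \<longrightarrow> - (pi / 2) < Arg \<nu> \<longrightarrow> Arg \<nu> < pi / 2 \<longrightarrow>
            set_integrable lborel {0<..}
              (\<lambda>t. of_real t ^ (2 * N) / (1 + (of_real t / \<nu>)\<^sup>2) * hankel_weight \<beta> t) \<and>
            set_integrable lborel {0<..}
              (\<lambda>t. exp (\<nu> * of_real t - \<nu> * of_real (sec \<beta>) * of_real (sinh t))) \<and>
            anger_weber (- \<nu>) (\<nu> * of_real (sec \<beta>)) =
              - (1 / of_real pi) *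
                (\<Sum>n<N. fact (2 * n) * of_real (anger_weber_coeff n (- sec \<beta>)) / \<nu> ^ (2 * n + 1))
              + anger_weber_remainder N \<nu> \<beta>)"
proof -
  \<comment> \<open>Any height strictly between 0 and \<beta> would do.\<close>
  interpret sinh_phase \<beta> "\<beta> / 2" using assms by unfold_locales auto
  \<comment> \<open>W agrees with the Hankel weight for t > 0, which is the whole domain of
    integration.\<close>
  have int_cong: "set_integrable lborel {0<..} (\<lambda>t. q t * hankel_weight \<beta> t) \<longleftrightarrow>
      set_integrable lborel {0<..} (\<lambda>t. q t * W t)" for q
    by (intro set_integrable_cong) (auto simp: hankel_weight_eq)
  have lint_cong: "(LINT t:{0<..}|lborel. q t * hankel_weight \<beta> t) = (LINT t:{0<..}|lborel. q t * W t)" for q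
    by (intro set_lebesgue_integral_cong) (auto simp: hankel_weight_eq)
  define M where "M = (\<lambda>n. LINT t:{0<..}|lborel. complex_of_real t ^ (2 * n) * W t)"
  define D where "D = (\<lambda>n. (deriv ^^ (2 * n)) (\<lambda>t. sinh_quotient s t ^ (2 * n + 1)) 0)"
  have M: "M n = of_real ((-1) ^ n * D n)" for n
    unfolding M_def D_def by (rule weight_moment)
  have coeff: "anger_weber_coeff n (- sec \<beta>) = - (1 / fact (2 * n)) * D n" for n
    unfolding anger_weber_coeff_def D_def s_def by simp
  \<comment> \<open>Two factors (-1)^n cancel, one from the moment and one from the geometric
    series; the minus sign of the coefficients accounts for the prefactor - 1 / pi.\<close>
  have coeff': "fact (2 * n) * complex_of_real (anger_weber_coeff n (- sec \<beta>)) = - ((-1) ^ n * M n)" for n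
    unfolding coeff M by (cases "even n") simp_all
  have phase: "exp (\<nu> * of_real t - \<nu> * of_real (sec \<beta>) * of_real (sinh t)) = exp (- (\<nu> * of_real (hr t)))"
    for \<nu> :: complex and t
    by (simp add: hr_def s_def algebra_simps)
  show ?thesis
  proof (intro conjI allI impI)
    fix n
    show "set_integrable lborel {0<..} (\<lambda>t. of_real t ^ (2 * n) * hankel_weight \<beta> t)"
      unfolding int_cong by (rule moment_integrable)
    have "complex_of_real (anger_weber_coeff n (- sec \<beta>)) = (-1) ^ (n + 1) / fact (2 * n) * M n"
      unfolding coeff M by (cases "even n") simp_all
    then show "complex_of_real (anger_weber_coeff n (- sec \<beta>)) = (-1) ^ (n + 1) / fact (2 * n) *
        (LINT t:{0<..}|lborel. of_real t ^ (2 * n) * hankel_weight \<beta> t)"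
      unfolding lint_cong M_def .
  next
    fix \<nu> :: complex
    assume "\<nu> \<noteq> 0" "- (pi / 2) < Arg \<nu>" "Arg \<nu> < pi / 2"
    \<comment> \<open>The sector condition is used in the form Re \<nu> > 0.\<close>
    then have "\<bar>Arg \<nu>\<bar> < pi / 2" by linarith
    with \<open>\<nu> \<noteq> 0\<close> have \<nu>: "0 < Re \<nu>"
      using Arg_Re_pos[of \<nu>] by blast
    show "set_integrable lborel {0<..} (\<lambda>t. of_real t ^ (2 * N) / (1 + (of_real t / \<nu>)\<^sup>2) * hankel_weight \<beta> t)"
      unfolding int_cong by (rule remainder_integrable[OF \<nu>])
    show "set_integrable lborel {0<..} (\<lambda>t. exp (\<nu> * of_real t - \<nu> * of_real (sec \<beta>) * of_real (sinh t)))"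
      unfolding phase by (rule set_integrable_exp_hr_complex[OF \<nu>])
    have "anger_weber (- \<nu>) (\<nu> * of_real (sec \<beta>)) =
        1 / of_real pi * (LINT x:{0<..}|lborel. exp (- (\<nu> * of_real (hr x))))"
      unfolding anger_weber_def minus_minus phase ..
    also have "\<dots> = 1 / of_real pi * (\<Sum>n<N. (-1) ^ n * M n / \<nu> ^ (2 * n + 1)) +
        1 / of_real pi * ((-1) ^ N / \<nu> ^ (2 * N + 1) * remainder_integral \<nu> N)"
      unfolding laplace_hr_expansion[OF \<nu>, of N] M_def by (rule distrib_left)
    also have "1 / of_real pi * ((-1) ^ N / \<nu> ^ (2 * N + 1) * remainder_integral \<nu> N) = anger_weber_remainder N \<nu> \<beta>"
      unfolding anger_weber_remainder_def remainder_integral_def lint_cong by simp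
    also have "1 / of_real pi * (\<Sum>n<N. (-1) ^ n * M n / \<nu> ^ (2 * n + 1)) = - (1 / of_real pi) *
        (\<Sum>n<N. fact (2 * n) * of_real (anger_weber_coeff n (- sec \<beta>)) / \<nu> ^ (2 * n + 1))"
      unfolding coeff' by (simp add: sum_negf)
    finally show "anger_weber (- \<nu>) (\<nu> * of_real (sec \<beta>)) = - (1 / of_real pi) *
          (\<Sum>n<N. fact (2 * n) * of_real (anger_weber_coeff n (- sec \<beta>)) / \<nu> ^ (2 * n + 1))
        + anger_weber_remainder N \<nu> \<beta>" .
  qed
qed

end
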